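(* Suppose $p\neq2$ and let $\alpha,\beta,\gamma\in\widehat{\mathbb{F}_q^\times}$. (i) For $\lambda\in\mathbb{F}_q$, $$F_4\!\left({\alpha;\beta\atop\gamma\phi,\phi};\lambda^2,(1-\lambda)^2\right)=(\alpha)_\phi(\beta)_\phi\,F_4\!\left({\alpha\phi;\beta\phi\atop\gamma\phi,\phi};\lambda^2,(1-\lambda)^2\right).$$ (ii) Suppose $\varepsilon\notin\{\alpha,\overline{\beta}\gamma\}$. Then for $\lambda\in\mathbb{F}_q$, $\lambda\neq1$, $$F_4\!\left({\alpha;\beta\atop\gamma\phi,\phi};\lambda^2,(1-\lambda)^2\right)=\frac{g(\overline{\alpha}\beta)g(\alpha\phi)}{g(\beta)g(\phi)}\,\overline{\alpha}^2(1-\lambda)\,F_4\!\left({\alpha;\alpha\phi\atop\gamma\phi,\alpha\overline{\beta}};\frac{\lambda^2}{(1-\lambda)^2},\frac{1}{(1-\lambda)^2}\right).$$ (iii) Suppose $\varepsilon\notin\{\alpha\overline{\beta}\phi,\gamma\}$. Then for $\lambda\in\mathbb{F}_q$, $\lambda\neq1$, $$\overline{\alpha}^2(1-\lambda)\,F_4\!\left({\alpha;\alpha\phi\atop\gamma\phi,\alpha\overline{\beta}};\frac{\lambda^2}{(1-\lambda)^2},\frac{1}{(1-\lambda)^2}\right)=\frac{g(\beta)g(\beta\phi)}{g(\overline{\alpha}\beta)g^\circ(\alpha\beta\phi)}\,{}_3F_2\!\left({\alpha^2,\beta^2,\gamma\atop\alpha\beta\phi,\gamma^2};\lambda\right).$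$
   Context: $\mathbb{F}_q$ is a finite field with $q$ elements and characteristic $p$. $\widehat{\mathbb{F}_q^\times}$ is the group of multiplicative characters $\mathbb{F}_q^\times\to\overline{\mathbb{Q}}^\times$, $\varepsilon$ the trivial character, $\phi$ the quadratic character; every character (including $\varepsilon$) is extended by $0$ at $0$; $\overline{\eta}=\eta^{-1}$; $\delta(\eta)=1$ if $\eta=\varepsilon$, else $0$. $\psi$ is a fixed non-trivial additive character. $g(\eta)=-\sum_{x\in\mathbb{F}_q^\times}\psi(x)\eta(x)$, $g^\circ(\eta)=q^{\delta(\eta)}g(\eta)$, $(\alpha)_\nu=g(\alpha\nu)/g(\alpha)$, $(\alpha)^\circ_\nu=g^\circ(\alpha\nu)/g^\circ(\alpha)$. For $\lambda\in\mathbb{F}_q$, ${}_3F_2\!\left({\alpha_1,\alpha_2,\alpha_3\atop\beta_1,\beta_2};\lambda\right)=\frac{1}{1-q}\sum_{\nu}\frac{(\alpha_1)_\nu(\alpha_2)_\nu(\alpha_3)_\nu}{(\varepsilon)^\circ_\nu(\beta_1)^\circ_\nu(\beta_2)^\circ_\nu}\nu(\lambda)$; Appell's function: for $x,y\in\mathbb{F}_q$, $F_4\!\left({\alpha;\beta\atop\gamma_1,\gamma_2};x,y\right)=\frac{1}{(1-q)^2}\sum_{\nu_1,\nu_2}\frac{(\alpha)_{\nu_1\nu_2}(\beta)_{\nu_1\nu_2}}{(\gamma_1)^\circ_{\nu_1}(\gamma_2)^\circ_{\nu_2}(\varepsilon)^\circ_{\nu_1}(\varepsilon)^\circ_{\nu_2}}\nu_1(x)\nu_2(y)$,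 sums over characters. *)

theory Defs
  imports Complex_Main
begin

definition mchars :: "('a::{field,finite} \<Rightarrow> complex) set" where
  "mchars = {\<chi>. \<chi> 0 = 0 \<and> (\<forall>x. x \<noteq> 0 \<longrightarrow> \<chi> x \<noteq> 0) \<and> (\<forall>x y. \<chi> (x * y) = \<chi> x * \<chi> y)}"

definition triv_char :: "'a::{field,finite} \<Rightarrow> complex" where
  "triv_char x = (if x = 0 then 0 else 1)"

definition quad_char :: "'a::{field,finite} \<Rightarrow> complex" where
  "quad_char x = (if x = 0 then 0 else if (\<exists>y. x = y ^ 2) then 1 else -1)"

definition chmul :: "('a::{field,finite} \<Rightarrow> complex) \<Rightarrow> ('a \<Rightarrow> complex) \<Rightarrow> 'a \<Rightarrow> complex" where
  "chmul \<chi> \<eta> = (\<lambda>x. \<chi> x * \<eta> x)"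

definition chinv :: "('a::{field,finite} \<Rightarrow> complex) \<Rightarrow> 'a \<Rightarrow> complex" where
  "chinv \<chi> = (\<lambda>x. if x = 0 then 0 else inverse (\<chi> x))"

definition nontriv_add_char :: "('a::{field,finite} \<Rightarrow> complex) \<Rightarrow> bool" where
  "nontriv_add_char \<psi> \<longleftrightarrow> (\<forall>x y. \<psi> (x + y) = \<psi> x * \<psi> y) \<and> (\<exists>x. \<psi> x \<noteq> 1)"

definition gauss :: "('a::{field,finite} \<Rightarrow> complex) \<Rightarrow> ('a \<Rightarrow> complex) \<Rightarrow> complex" where
  "gauss \<psi> \<eta> = - (\<Sum>x\<in>UNIV - {0}. \<psi> x * \<eta> x)"

definition delta :: "('a::{field,finite} \<Rightarrow> complex) \<Rightarrow> nat" where
  "delta \<eta> = (if \<eta> = triv_char then 1 else 0)"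

definition gauss0 :: "('a::{field,finite} \<Rightarrow> complex) \<Rightarrow> ('a \<Rightarrow> complex) \<Rightarrow> complex" where
  "gauss0 \<psi> \<eta> = of_nat (card (UNIV :: 'a set)) ^ delta \<eta> * gauss \<psi> \<eta>"

definition poch :: "('a::{field,finite} \<Rightarrow> complex) \<Rightarrow> ('a \<Rightarrow> complex) \<Rightarrow> ('a \<Rightarrow> complex) \<Rightarrow> complex" where
  "poch \<psi> \<alpha> \<nu> = gauss \<psi> (chmul \<alpha> \<nu>) / gauss \<psi> \<alpha>"

definition poch0 :: "('a::{field,finite} \<Rightarrow> complex) \<Rightarrow> ('a \<Rightarrow> complex) \<Rightarrow> ('a \<Rightarrow> complex) \<Rightarrow> complex" where
  "poch0 \<psi> \<alpha> \<nu> = gauss0 \<psi> (chmul \<alpha> \<nu>) / gauss0 \<psi> \<alpha>"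

definition F32 :: "('a::{field,finite} \<Rightarrow> complex) \<Rightarrow> ('a \<Rightarrow> complex) \<Rightarrow> ('a \<Rightarrow> complex) \<Rightarrow> ('a \<Rightarrow> complex)
    \<Rightarrow> ('a \<Rightarrow> complex) \<Rightarrow> ('a \<Rightarrow> complex) \<Rightarrow> 'a \<Rightarrow> complex" where
  "F32 \<psi> a1 a2 a3 b1 b2 lam = 1 / (1 - of_nat (card (UNIV :: 'a set))) *
     (\<Sum>\<nu>\<in>mchars. poch \<psi> a1 \<nu> * poch \<psi> a2 \<nu> * poch \<psi> a3 \<nu> /
        (poch0 \<psi> triv_char \<nu> * poch0 \<psi> b1 \<nu> * poch0 \<psi> b2 \<nu>) * \<nu> lam)"

definition F4 :: "('a::{field,finite} \<Rightarrow> complex) \<Rightarrow> ('a \<Rightarrow> complex) \<Rightarrow> ('a \<Rightarrow> complex) \<Rightarrow> ('a \<Rightarrow> complex)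
    \<Rightarrow> ('a \<Rightarrow> complex) \<Rightarrow> 'a \<Rightarrow> 'a \<Rightarrow> complex" where
  "F4 \<psi> a b c1 c2 x y = 1 / (1 - of_nat (card (UNIV :: 'a set))) ^ 2 *
     (\<Sum>\<nu>1\<in>mchars. \<Sum>\<nu>2\<in>mchars.
        poch \<psi> a (chmul \<nu>1 \<nu>2) * poch \<psi> b (chmul \<nu>1 \<nu>2) /
        (poch0 \<psi> c1 \<nu>1 * poch0 \<psi> c2 \<nu>2 * poch0 \<psi> triv_char \<nu>1 * poch0 \<psi> triv_char \<nu>2)
        * \<nu>1 x * \<nu>2 y)"

end

(* Put K_{a,b}(z) = sum_s a(s) b(z/s) psi(s + z/s). Its Mellin transform at nu is g(a nu) g(b nu), so with
   J_c = K_{1/c,eps}, Mellin inversion and reflection turn F4(a; b; c, d; x, y) into a constant times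
   sum_z K_{a,b}(z) J_c(x z) J_d(y z). Part (i) follows as twisting a and b by phi multiplies K_{a,b}(z)
   by phi(z), which J_phi(m^2 z) absorbs. Part (ii) is the substitution z -> (1 - lambda)^2 z together
   with K_{a,a phi} = a J_phi and a J_{a/b} = K_{a,b}. For part (iii), J_phi(m^2 z) is a Salie sum,
   -g(phi) sum_{w^2 = z} psi(2 m w); as 2 (1 - lambda) w = 2 w - 2 lambda w, the sum over w becomes a
   multiplicative correlation of two one-variable sums whose Mellin transforms are Jacobi sums. Mellin
   inversion in lambda, Hasse-Davenport for 2 and reflection then give the 3F2. *)
theory Submission
  imports Defs "HOL-Algebra.Multiplicative_Group"
begin

text \<open>The series have \<open>G\<close> in numerators and \<open>G0\<close> in denominators.
  Reflection pairs exactly one with the other,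
  \<open>G \<eta> * G0 (chinv \<eta>) = q * \<eta> (- 1)\<close>, with the trivial character
  included. Hence denominators can be moved into Mellin transforms without splitting off degenerate
  characters. The case that does not fit is the Jacobi sum of two trivial characters, which carries
  a correction term; the hypotheses of (iii) exclude it where nothing compensates it. The
  one-variable sums in (iii) exist because s + w^2/s - 2 w = (s - w)^2/s: the two halves of the
  linear phase left by the Salie sum complete the squares in the two remaining Kloosterman sums. All
  kernels vanish at 0, so Mellin inversion also holds at 0 and \<lambda> = 0 is not a special
  case.\<close>

section \<open>The cyclic group of units of a finite field\<close>

lemma power_card_minus_one:
  fixes a :: "'a::{field,finite}"
  assumes "a \<noteq> 0"
  shows "a ^ (card (UNIV :: 'a set) - 1) = 1"
proof -
  have "(\<Prod>x\<in>UNIV - {0}. a * x) = (\<Prod>x\<in>UNIV - {0::'a}. x)"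
    by (rule prod.reindex_bij_witness[where i = "\<lambda>x. x / a" and j = "\<lambda>x. a * x"]) (use assms in auto)
  then show ?thesis
    by (simp add: prod.distrib card_Diff_singleton)
qed

text \<open>Cyclicity of the unit group is a theorem about the record-based fields of
  \<open>HOL-Algebra\<close>; the type is packaged as such a record \<open>R\<close>, and
  \<open>pow\<close> translates powers back.\<close>

lemma generator_of_units:
  "\<exists>a::'a::{field,finite}. a \<noteq> 0 \<and> (\<forall>x. x \<noteq> 0 \<longrightarrow> (\<exists>i::nat. x = a ^ i))"
proof -
  define R :: "'a ring" where "R = \<lparr>carrier = UNIV, monoid.mult = (*), one = 1, zero = 0, add = (+)\<rparr>"
  have inv: "\<exists>y. x * y = 1" if "x \<noteq> 0" for x :: 'a
    using that right_inverse by blast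
  interpret R: Ring.field R
  proof (rule cring.cring_fieldI)
    show "cring R"
      by (intro cringI abelian_groupI Group.comm_monoidI)
        (auto simp: R_def algebra_simps intro: exI[of _ "- _"])
    show "Units R = carrier R - {\<zero>\<^bsub>R\<^esub>}"
      using inv by (auto simp: R_def Units_def mult.commute)
  qed
  have pow: "x [^]\<^bsub>R\<^esub> (i::nat) = x ^ i" for x i
    by (induction i) (auto simp: R_def nat_pow_def mult.commute)
  obtain a where a: "a \<in> carrier (mult_of R)" "carrier (mult_of R) = {a[^]\<^bsub>R\<^esub>i | i::nat. i \<in> UNIV}"
    using R.finite_field_mult_group_has_gen by (auto simp: R_def)
  then show ?thesis
    unfolding pow by (intro exI[of _ a]) (auto simp: R_def)
qed

lemma primitive_element:
  obtains a :: "'a::{field,finite}" and n where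
    "n = card (UNIV :: 'a set) - 1" "n > 0" "a \<noteq> 0" "\<And>x. x \<noteq> 0 \<Longrightarrow> \<exists>i. x = a ^ i"
    "\<And>i j. a ^ i = a ^ j \<longleftrightarrow> i mod n = j mod n"
proof -
  define n where "n = card (UNIV :: 'a set) - 1"
  obtain a :: 'a where a: "a \<noteq> 0" "\<And>x. x \<noteq> 0 \<Longrightarrow> \<exists>i. x = a ^ i"
    using generator_of_units by blast
  have cardU: "card (UNIV - {0::'a}) = n"
    by (simp add: n_def card_Diff_singleton)
  moreover have "UNIV - {0::'a} \<noteq> {}"
    using one_neq_zero by blast
  ultimately have n: "n > 0"
    by (metis card_gt_0_iff finite)
  have an: "a ^ n = 1"
    using power_card_minus_one[OF a(1)] by (simp add: n_def)
  have mod: "a ^ (i mod n) = a ^ i" for i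
    by (metis an mult_1 mult_div_mod_eq power_add power_mult power_one)
  have "(\<lambda>i. a ^ i) ` {..<n} = UNIV - {0}"
  proof (intro equalityI subsetI)
    fix x :: 'a assume "x \<in> UNIV - {0}"
    then obtain i where "x = a ^ i" using a(2) by blast
    then have "x = a ^ (i mod n)" by (simp add: mod)
    then show "x \<in> (\<lambda>i. a ^ i) ` {..<n}" using n by auto
  qed (use a in auto)
  \<comment> \<open>A map from \<open>n\<close> exponents onto \<open>n\<close> units is injective,
    so the order of \<open>a\<close> is exactly \<open>n\<close>.\<close>
  then have "inj_on (\<lambda>i. a ^ i) {..<n}"
    using cardU by (intro eq_card_imp_inj_on) auto
  then have "a ^ i = a ^ j \<longleftrightarrow> i mod n = j mod n" for i j
    using n by (metis mod inj_onD lessThan_iff mod_less_divisor)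
  with a n show ?thesis using that[of n a] by (simp add: n_def)
qed

section \<open>The group of multiplicative characters\<close>

lemma
  fixes \<chi> :: "'a::{field,finite} \<Rightarrow> complex"
  assumes "\<chi> \<in> mchars"
  shows mchar_0: "\<chi> 0 = 0"
    and mchar_eq_0_iff: "\<chi> x = 0 \<longleftrightarrow> x = 0"
    and mchar_mult: "\<chi> (x * y) = \<chi> x * \<chi> y"
  using assms by (auto simp: mchars_def)

lemma
  fixes \<chi> :: "'a::{field,finite} \<Rightarrow> complex"
  assumes "\<chi> \<in> mchars"
  shows mchar_1: "\<chi> 1 = 1"
    and mchar_power: "\<chi> (x ^ k) = \<chi> x ^ k"
    and mchar_inverse: "\<chi> (inverse x) = inverse (\<chi> x)"
proof -
  have "\<chi> 1 * \<chi> 1 = \<chi> 1" "\<chi> 1 \<noteq> 0"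
    using assms mchar_mult[OF assms, of 1 1] by (auto simp: mchar_eq_0_iff[OF assms])
  then show 1: "\<chi> 1 = 1" by simp
  show "\<chi> (x ^ k) = \<chi> x ^ k"
    by (induction k) (simp_all add: 1 mchar_mult[OF assms])
  show "\<chi> (inverse x) = inverse (\<chi> x)"
  proof (cases "x = 0")
    case False
    then have "\<chi> x * \<chi> (inverse x) = 1"
      by (simp add: 1 flip: mchar_mult[OF assms])
    then show ?thesis by (simp add: inverse_unique)
  qed (simp add: mchar_0[OF assms])
qed

lemmas mchar_simps = mchar_0 mchar_eq_0_iff mchar_1

lemma mchar_minus_1_square:
  fixes \<chi> :: "'a::{field,finite} \<Rightarrow> complex"
  assumes "\<chi> \<in> mchars"
  shows "\<chi> (- 1) * \<chi> (- 1) = 1"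
  by (simp add: mchar_1[OF assms] flip: mchar_mult[OF assms])

lemma mchar_minus_1:
  fixes \<chi> :: "'a::{field,finite} \<Rightarrow> complex"
  assumes "\<chi> \<in> mchars"
  shows "inverse (\<chi> (- 1)) = \<chi> (- 1)"
  using mchar_minus_1_square[OF assms] by (simp add: inverse_unique)

lemma mchar_minus:
  fixes \<chi> :: "'a::{field,finite} \<Rightarrow> complex"
  assumes "\<chi> \<in> mchars"
  shows "\<chi> (- x) = \<chi> (- 1) * \<chi> x"
  by (metis assms mchar_mult mult_minus1)

lemma chinv_apply:
  fixes \<chi> :: "'a::{field,finite} \<Rightarrow> complex"
  assumes "\<chi> \<in> mchars"
  shows "chinv \<chi> x = inverse (\<chi> x)"
  by (simp add: chinv_def mchar_0[OF assms])

lemma triv_char_mchar [simp]: "triv_char \<in> mchars"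
  by (auto simp: triv_char_def mchars_def)

lemma chmul_mchar [simp]: "\<chi> \<in> mchars \<Longrightarrow> \<eta> \<in> mchars \<Longrightarrow> chmul \<chi> \<eta> \<in> mchars"
  by (auto simp: chmul_def mchars_def)

lemma chinv_mchar [simp]:
  assumes "\<chi> \<in> mchars" shows "chinv \<chi> \<in> mchars"
  using assms by (auto simp: chinv_def mchars_def)

lemma chmul_triv [simp]:
  "\<chi> \<in> mchars \<Longrightarrow> chmul \<chi> triv_char = \<chi>"
  "\<chi> \<in> mchars \<Longrightarrow> chmul triv_char \<chi> = \<chi>"
  by (auto simp: chmul_def triv_char_def fun_eq_iff mchar_0)

lemma chmul_commute: "chmul \<chi> \<eta> = chmul \<eta> \<chi>"
  by (simp add: chmul_def mult.commute)

lemma chmul_assoc: "chmul (chmul \<chi> \<eta>) \<theta> = chmul \<chi> (chmul \<eta> \<theta>)"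
  by (simp add: chmul_def mult.assoc)

lemma chmul_left_commute: "chmul \<chi> (chmul \<eta> \<theta>) = chmul \<eta> (chmul \<chi> \<theta>)"
  by (simp add: chmul_def mult.left_commute)

lemmas chmul_ac = chmul_assoc chmul_commute chmul_left_commute

lemma chmul_chinv [simp]:
  assumes "\<chi> \<in> mchars"
  shows "chmul \<chi> (chinv \<chi>) = triv_char" "chmul (chinv \<chi>) \<chi> = triv_char"
  by (auto simp: chmul_def chinv_def triv_char_def fun_eq_iff mchar_simps[OF assms])

lemma chmul_chinv_cancel [simp]:
  assumes "\<chi> \<in> mchars" "\<eta> \<in> mchars"
  shows "chmul \<chi> (chmul (chinv \<chi>) \<eta>) = \<eta>" "chmul (chinv \<chi>) (chmul \<chi> \<eta>) = \<eta>"
  using assms by (simp_all flip: chmul_assoc)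

lemma chinv_chinv [simp]: "\<chi> \<in> mchars \<Longrightarrow> chinv (chinv \<chi>) = \<chi>"
  by (auto simp: chinv_def fun_eq_iff mchar_0)

lemma chinv_chmul [simp]:
  "chinv (chmul \<chi> \<eta>) = chmul (chinv \<chi>) (chinv \<eta>)"
  by (auto simp: chinv_def chmul_def fun_eq_iff)

lemma chinv_triv [simp]: "chinv triv_char = triv_char"
  by (auto simp: chinv_def triv_char_def)

lemma chinv_eq_triv_iff [simp]:
  assumes "\<chi> \<in> mchars" shows "chinv \<chi> = triv_char \<longleftrightarrow> \<chi> = triv_char"
  using assms by (metis chinv_chinv chinv_triv)

section \<open>Orthogonality of characters and Mellin inversion\<close>

lemma sum_scale:
  fixes w :: "'a::{field,finite}"
  assumes "w \<noteq> 0"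
  shows "(\<Sum>x\<in>UNIV. f (w * x)) = (\<Sum>x\<in>UNIV. f x)"
  by (rule sum.reindex_bij_witness[where i = "\<lambda>x. x / w" and j = "\<lambda>x. w * x"]) (use assms in auto)

lemma sum_inverse:
  "(\<Sum>x\<in>(UNIV :: 'a::{field,finite} set). f (inverse x)) = (\<Sum>x\<in>UNIV. f x)"
  by (rule sum.reindex_bij_witness[where i = inverse and j = inverse]) auto

lemma sum_divide_swap:
  fixes z :: "'a::{field,finite}"
  assumes "z \<noteq> 0"
  shows "(\<Sum>x\<in>UNIV. f (z / x)) = (\<Sum>x\<in>UNIV. f x)"
  using sum_inverse[of "\<lambda>x. f (z * x)"] sum_scale[OF assms, of f] by (simp add: divide_inverse)

lemma sum_mchar:
  fixes \<chi> :: "'a::{field,finite} \<Rightarrow> complex"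
  assumes "\<chi> \<in> mchars"
  shows "(\<Sum>x\<in>UNIV. \<chi> x) = (if \<chi> = triv_char then of_nat (card (UNIV :: 'a set)) - 1 else 0)"
proof (cases "\<chi> = triv_char")
  case True
  have "(\<Sum>x\<in>(UNIV :: 'a set). triv_char x) = (\<Sum>x\<in>UNIV - {0::'a}. 1)"
    by (rule sum.mono_neutral_cong_right) (auto simp: triv_char_def)
  also have "\<dots> = of_nat (card (UNIV :: 'a set)) - 1"
    by (simp add: card_Diff_singleton Suc_leI finite_UNIV_card_ge_0 of_nat_diff)
  finally show ?thesis using True by simp
next
  case False
  then obtain w where "\<chi> w \<noteq> triv_char w" by blast
  then have w: "w \<noteq> 0" "\<chi> w \<noteq> 1"
    by (auto simp: triv_char_def mchar_simps[OF assms] split: if_splits)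
  have "(\<Sum>x\<in>UNIV. \<chi> x) = \<chi> w * (\<Sum>x\<in>UNIV. \<chi> x)"
    using sum_scale[OF w(1), of \<chi>] by (simp add: mchar_mult[OF assms] sum_distrib_left)
  then show ?thesis using w(2) False by simp
qed

text \<open>Character values are 0 or roots of unity of order dividing q - 1, so only finitely many
  functions qualify. A sum over an infinite set would be 0 by convention; finiteness gives the
  series their intended meaning.\<close>

lemma finite_mchars [simp]: "finite (mchars :: ('a::{field,finite} \<Rightarrow> complex) set)"
proof -
  let ?n = "card (UNIV :: 'a set) - 1"
  obtain a :: 'a and n where n: "n = ?n" "n > 0" and "a \<noteq> 0" using primitive_element by metis
  let ?R = "insert 0 {z :: complex. z ^ n = 1}"
  have "finite ?R" using n(2) by (simp add: finite_roots_unity)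
  moreover have "mchars \<subseteq> (UNIV :: 'a set) \<rightarrow>\<^sub>E ?R"
  proof
    fix \<chi> :: "'a \<Rightarrow> complex" assume \<chi>: "\<chi> \<in> mchars"
    have "\<chi> x ^ n = 1" if "x \<noteq> 0" for x
      using power_card_minus_one[OF that] by (simp add: n(1) mchar_1[OF \<chi>] flip: mchar_power[OF \<chi>])
    then have "\<chi> x \<in> ?R" for x
      by (cases "x = 0") (simp_all add: mchar_0[OF \<chi>])
    then show "\<chi> \<in> UNIV \<rightarrow>\<^sub>E ?R" by blast
  qed
  ultimately show ?thesis
    by (meson finite_PiE finite_subset finite_UNIV)
qed

text \<open>The character that sends a generator to a primitive \<open>n\<close>-th root of unity is
  injective on the units, so this single character separates every such \<open>x\<close> from
  1.\<close>

lemma separating_mchar: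
  fixes x :: "'a::{field,finite}"
  assumes "x \<noteq> 0" "x \<noteq> 1"
  obtains \<chi> :: "'a \<Rightarrow> complex" where "\<chi> \<in> mchars" "\<chi> x \<noteq> 1"
proof -
  obtain a :: 'a and n where n: "n > 0" and a: "a \<noteq> 0" "\<And>x. x \<noteq> 0 \<Longrightarrow> \<exists>i. x = a ^ i"
    "\<And>i j. a ^ i = a ^ j \<longleftrightarrow> i mod n = j mod n"
    using primitive_element by metis
  define z where "z = cis (2 * pi / n)"
  have zk: "z ^ k = cis (2 * pi * real k / real n)" for k
    by (simp add: z_def DeMoivre field_simps)
  have zn: "z ^ n = 1" using n by (simp add: zk)
  have zmod: "z ^ (k mod n) = z ^ k" for k
    by (metis zn mult_1 mult_div_mod_eq power_add power_mult power_one)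
  have inj: "inj_on (\<lambda>k. z ^ k) {..<n}"
    using bij_betw_roots_unity[OF n] by (simp add: zk bij_betw_def)
  \<comment> \<open>\<open>d\<close> is a discrete logarithm, chosen arbitrarily in its class modulo
    \<open>n\<close>; as \<open>z ^ n = 1\<close>, the choice does not affect
    \<open>\<chi>\<close>.\<close>
  define d where "d y = (SOME i. y = a ^ i)" for y
  have d: "a ^ d y = y" if "y \<noteq> 0" for y
    using someI_ex[OF a(2)[OF that]] by (simp add: d_def)
  define \<chi> where "\<chi> y = (if y = 0 then 0 else z ^ d y)" for y
  have "\<chi> \<in> mchars"
  proof -
    have "\<chi> (x * y) = \<chi> x * \<chi> y" for x y
    proof (cases "x = 0 \<or> y = 0")
      case False
      have "a ^ d (x * y) = a ^ (d x + d y)"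
        using False by (simp add: d power_add)
      then have "d (x * y) mod n = (d x + d y) mod n" by (simp add: a(3))
      then have "z ^ d (x * y) = z ^ (d x + d y)"
        using zmod[of "d (x * y)"] zmod[of "d x + d y"] by argo
      then show ?thesis using False by (simp add: \<chi>_def power_add)
    qed (auto simp: \<chi>_def)
    moreover have "\<chi> x \<noteq> 0" if "x \<noteq> 0" for x
      using that by (simp add: \<chi>_def z_def)
    moreover have "\<chi> 0 = 0" by (simp add: \<chi>_def)
    ultimately show ?thesis by (simp add: mchars_def)
  qed
  moreover have "\<chi> x \<noteq> 1"
  proof
    assume "\<chi> x = 1"
    then have "z ^ (d x mod n) = z ^ 0" using assms by (simp add: \<chi>_def zmod)
    then have "d x mod n = 0" using inj_onD[OF inj, of "d x mod n" 0] n by simp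
    then have "a ^ d x = a ^ 0" using a(3)[of "d x" 0] by simp
    then show False using d assms by simp
  qed
  ultimately show ?thesis using that by blast
qed

lemma sum_mchars_eq_0:
  fixes x :: "'a::{field,finite}"
  assumes "x \<noteq> 1"
  shows "(\<Sum>\<chi>\<in>mchars. \<chi> x) = 0"
proof (cases "x = 0")
  case False
  obtain \<eta> :: "'a \<Rightarrow> complex" where \<eta>: "\<eta> \<in> mchars" "\<eta> x \<noteq> 1"
    using separating_mchar[OF False assms] .
  have "(\<Sum>\<chi>\<in>mchars. \<chi> x) = (\<Sum>\<chi>\<in>mchars. chmul \<eta> \<chi> x)"
    by (rule sum.reindex_bij_witness[where j = "chmul (chinv \<eta>)" and i = "chmul \<eta>"]) (use \<eta> in auto)
  also have "\<dots> = \<eta> x * (\<Sum>\<chi>\<in>mchars. \<chi> x)"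
    by (simp add: chmul_def sum_distrib_left)
  finally show ?thesis using \<eta>(2) by simp
qed (simp add: mchar_0)

text \<open>Summing \<open>\<chi> y\<close> over all \<open>y\<close> and all \<open>\<chi>\<close>
  in both orders settles the value at 1: one order keeps only \<open>y = 1\<close>, the other only
  the trivial character. The number of characters comes out as q - 1 without a description of the
  dual group.\<close>

lemma sum_mchars:
  fixes x :: "'a::{field,finite}"
  shows "(\<Sum>\<chi>\<in>mchars. \<chi> x) = (if x = 1 then of_nat (card (UNIV :: 'a set)) - 1 else 0)"
proof (cases "x = 1")
  case True
  have "(\<Sum>y\<in>(UNIV::'a set). \<Sum>\<chi>\<in>mchars. \<chi> y) = (\<Sum>y\<in>(UNIV::'a set). if y = 1 then \<Sum>\<chi>\<in>mchars. \<chi> y else 0)"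
    by (intro sum.cong refl) (simp add: sum_mchars_eq_0)
  then have "(\<Sum>\<chi>\<in>mchars. \<chi> (1::'a)) = (\<Sum>\<chi>\<in>mchars. \<Sum>y\<in>(UNIV::'a set). \<chi> y)"
    by (subst sum.swap) simp
  also have "\<dots> = of_nat (card (UNIV :: 'a set)) - 1"
    by (simp add: sum_mchar)
  finally show ?thesis using True by simp
qed (simp add: sum_mchars_eq_0)

text \<open>Orthogonality in the character variable picks out \<open>w = u\<close>. The condition at
  0 is forced, since every character vanishes there; with it the formula covers \<open>u = 0\<close>
  too.\<close>

lemma mellin_inversion:
  fixes f :: "'a::{field,finite} \<Rightarrow> complex"
  assumes "f 0 = 0"
  shows "(\<Sum>\<nu>\<in>mchars. (\<Sum>w\<in>UNIV. f w * chinv \<nu> w) * \<nu> u) = (of_nat (card (UNIV :: 'a set)) - 1) * f u"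
proof -
  have "(\<Sum>\<nu>\<in>mchars. (\<Sum>w\<in>UNIV. f w * chinv \<nu> w) * \<nu> u) = (\<Sum>\<nu>\<in>mchars. \<Sum>w\<in>UNIV. f w * \<nu> (u / w))"
    unfolding sum_distrib_right
  proof (intro sum.cong refl)
    fix \<nu> :: "'a \<Rightarrow> complex" and w assume \<nu>: "\<nu> \<in> mchars"
    show "f w * chinv \<nu> w * \<nu> u = f w * \<nu> (u / w)"
      by (simp add: chinv_apply[OF \<nu>] mchar_mult[OF \<nu>] mchar_inverse[OF \<nu>] divide_inverse)
  qed
  also have "\<dots> = (\<Sum>w\<in>UNIV. f w * (\<Sum>\<nu>\<in>mchars. \<nu> (u / w)))"
    by (subst sum.swap) (simp add: sum_distrib_left)
  also have "\<dots> = (\<Sum>w\<in>UNIV. if w = u then (of_nat (card (UNIV :: 'a set)) - 1) * f u else 0)"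
    by (intro sum.cong refl) (use assms in \<open>auto simp: sum_mchars divide_eq_1_iff\<close>)
  finally show ?thesis by simp
qed

section \<open>The quadratic character\<close>

text \<open>In odd characteristic the unit group has even order, so the parity of an exponent is
  well defined and the squares are the even powers of a generator.\<close>

lemma generator_quad_char:
  obtains a :: "'a::{field,finite}" where "a \<noteq> 0" "\<And>x. x \<noteq> 0 \<Longrightarrow> \<exists>i. x = a ^ i"
    "(2::'a) \<noteq> 0 \<Longrightarrow> (\<And>i. quad_char (a ^ i) = (- 1) ^ i)"
proof -
  obtain a :: 'a and n where n: "n > 0" and a: "a \<noteq> 0" "\<And>x. x \<noteq> 0 \<Longrightarrow> \<exists>i. x = a ^ i"
    "\<And>i j. a ^ i = a ^ j \<longleftrightarrow> i mod n = j mod n"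
    using primitive_element by metis
  have "quad_char (a ^ i) = (- 1) ^ i" if 2: "(2::'a) \<noteq> 0" for i
  proof -
    have m1: "(1::'a) \<noteq> - 1"
      using 2 by (metis add.right_inverse one_add_one)
    \<comment> \<open>The exponent of -1 shows that \<open>n\<close> is even: \<open>n\<close>
      divides \<open>2 * j\<close> but not \<open>j\<close>.\<close>
    obtain j where j: "- 1 = a ^ j" using a(2)[of "- 1"] by auto
    have "a ^ (2 * j) = a ^ 0"
      by (simp add: power_mult mult.commute[of 2] flip: j)
    then have "n dvd 2 * j" by (simp only: a(3)) auto
    moreover have "\<not> n dvd j"
    proof
      assume "n dvd j"
      then have "a ^ j = a ^ 0" by (simp only: a(3)) auto
      then show False using m1 j by simp
    qed
    ultimately have "even n"
      by (metis coprime_dvd_mult_right_iff coprime_right_2_iff_odd)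
    have "even i \<longleftrightarrow> (\<exists>y. a ^ i = y ^ 2)"
    proof
      assume "\<exists>y. a ^ i = y ^ 2"
      then obtain y where y: "a ^ i = y ^ 2" by blast
      then obtain k where "y = a ^ k" using a(1) a(2)[of y] by (cases "y = 0") auto
      with y have "a ^ i = a ^ (k * 2)" by (simp add: power_mult)
      then have "i mod n = (k * 2) mod n" by (simp only: a(3))
      then show "even i" using \<open>even n\<close> by (metis dvd_mod_iff dvd_triv_right)
    qed (metis dvdE mult.commute power_mult)
    then show ?thesis using a(1) by (simp add: quad_char_def)
  qed
  then show ?thesis using that a by blast
qed

text \<open>Multiplicativity is hidden in the definition by squares, where it says that a product of
  two nonsquares is a square. On powers of a generator it is additivity of parity.\<close>

lemma quad_char_mchar [simp]:
  assumes "(2::'a::{field,finite}) \<noteq> 0"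
  shows "(quad_char :: 'a \<Rightarrow> complex) \<in> mchars"
proof -
  obtain a :: 'a where a: "a \<noteq> 0" "\<And>x. x \<noteq> 0 \<Longrightarrow> \<exists>i. x = a ^ i"
    "\<And>i. quad_char (a ^ i) = (- 1) ^ i"
    using generator_quad_char assms by metis
  have "quad_char (x * y) = quad_char x * quad_char y" for x y :: 'a
  proof (cases "x = 0 \<or> y = 0")
    case False
    then obtain i j where "x = a ^ i" "y = a ^ j" using a(2) by blast
    then show ?thesis by (simp add: a(3) flip: power_add)
  qed (auto simp: quad_char_def)
  then show ?thesis by (auto simp: mchars_def quad_char_def)
qed

lemma quad_char_neq_triv:
  assumes "(2::'a::{field,finite}) \<noteq> 0"
  shows "(quad_char :: 'a \<Rightarrow> complex) \<noteq> triv_char"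
proof -
  obtain a :: 'a where a: "a \<noteq> 0" "\<And>i. quad_char (a ^ i) = (- 1) ^ i"
    using generator_quad_char assms by metis
  then have "quad_char a = - 1" using a(2)[of 1] by simp
  then show ?thesis using a(1) by (auto simp: triv_char_def fun_eq_iff intro!: exI[of _ a])
qed

lemma quad_char_square [simp]: "chmul quad_char quad_char = triv_char"
  by (auto simp: chmul_def quad_char_def triv_char_def)

lemma chinv_quad_char [simp]: "chinv quad_char = quad_char"
  by (auto simp: chinv_def quad_char_def)

text \<open>A character is determined by its value at a generator, here a square root of 1. This
  identifies the degenerate characters met later in Jacobi sums and in duplication formulas.\<close>

lemma mchar_square_eq_triv:
  fixes \<chi> :: "'a::{field,finite} \<Rightarrow> complex"
  assumes "(2::'a) \<noteq> 0" and \<chi>: "\<chi> \<in> mchars" and "chmul \<chi> \<chi> = triv_char"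
  shows "\<chi> = triv_char \<or> \<chi> = quad_char"
proof -
  obtain a :: 'a where a: "a \<noteq> 0" "\<And>x. x \<noteq> 0 \<Longrightarrow> \<exists>i. x = a ^ i"
    "\<And>i. quad_char (a ^ i) = (- 1) ^ i"
    using generator_quad_char assms(1) by metis
  have "\<chi> a * \<chi> a = 1"
    using fun_cong[OF assms(3), of a] a(1) by (simp add: chmul_def triv_char_def)
  then consider "\<chi> a = 1" | "\<chi> a = - 1"
    using square_eq_1_iff by blast
  then show ?thesis
  proof cases
    case 1
    then have "\<chi> x = triv_char x" for x
      using a(1) a(2)[of x] 1 by (cases "x = 0") (auto simp: triv_char_def mchar_0[OF \<chi>] mchar_power[OF \<chi>])
    then show ?thesis by blast
  next
    case 2
    then have "\<chi> x = quad_char x" for x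
      using a(2)[of x] 2 by (cases "x = 0") (auto simp: a(3) quad_char_def[of 0] mchar_0[OF \<chi>] mchar_power[OF \<chi>])
    then show ?thesis by blast
  qed
qed

section \<open>Additive character and Gauss sums\<close>

locale additive_character =
  fixes \<psi> :: "'a::{field,finite} \<Rightarrow> complex" and q :: complex
  assumes psi_add: "\<psi> (x + y) = \<psi> x * \<psi> y"
    and psi_0: "\<psi> 0 = 1"
    and psi_nontriv: "\<exists>x. \<psi> x \<noteq> 1"
    and two_neq_0: "(2::'a) \<noteq> 0"
    and q_eq: "q = of_nat (card (UNIV :: 'a set))"
begin

abbreviation G where "G \<equiv> gauss \<psi>"
abbreviation G0 where "G0 \<equiv> gauss0 \<psi>"
abbreviation \<phi> :: "'a \<Rightarrow> complex" where "\<phi> \<equiv> quad_char"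
abbreviation \<epsilon> :: "'a \<Rightarrow> complex" where "\<epsilon> \<equiv> triv_char"

lemma q_neq_0 [simp]: "q \<noteq> 0"
  by (simp add: q_eq)

lemma q_neq_1: "q - 1 \<noteq> 0"
proof -
  have "card (UNIV :: 'a set) \<noteq> 1"
    by (metis UNIV_I card_1_singletonE one_neq_zero singletonD)
  then show ?thesis by (simp add: q_eq)
qed

lemma phi_mchar [simp]: "\<phi> \<in> mchars"
  by (rule quad_char_mchar[OF two_neq_0])

lemma phi_neq_triv [simp]: "\<phi> \<noteq> \<epsilon>"
  by (rule quad_char_neq_triv[OF two_neq_0])

lemma sum_psi: "(\<Sum>x\<in>UNIV. \<psi> (c * x)) = (if c = 0 then q else 0)"
proof (cases "c = 0")
  case False
  obtain y where y: "\<psi> y \<noteq> 1" using psi_nontriv by blast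
  have "(\<Sum>x\<in>UNIV. \<psi> x) = (\<Sum>x\<in>UNIV. \<psi> (y + x))"
    by (rule sum.reindex_bij_witness[where j = "\<lambda>x. x - y" and i = "\<lambda>x. y + x"]) auto
  also have "\<dots> = \<psi> y * (\<Sum>x\<in>UNIV. \<psi> x)"
    by (simp add: psi_add sum_distrib_left)
  finally have "(\<Sum>x\<in>UNIV. \<psi> x) = 0" using y by simp
  then show ?thesis using sum_scale[OF False, of \<psi>] False by simp
qed (simp add: psi_0 q_eq)

lemma gauss_eq:
  assumes "\<eta> \<in> mchars"
  shows "G \<eta> = - (\<Sum>x\<in>UNIV. \<psi> x * \<eta> x)"
  unfolding gauss_def
  by (simp, rule sum.mono_neutral_left) (auto simp: mchar_0[OF assms])

lemma gauss_triv [simp]: "G \<epsilon> = 1"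
proof -
  have "(\<Sum>x\<in>UNIV - {0}. \<psi> x * \<epsilon> x) = (\<Sum>x\<in>UNIV - {0}. \<psi> x)"
    by (intro sum.cong) (auto simp: triv_char_def)
  also have "\<dots> = (\<Sum>x\<in>UNIV. \<psi> x) - \<psi> 0"
    by (simp add: sum_diff1)
  also have "\<dots> = - 1"
    using sum_psi[of 1] by (simp add: psi_0)
  finally show ?thesis by (simp add: gauss_def)
qed

lemma gauss0_triv [simp]: "G0 \<epsilon> = q"
  by (simp add: gauss0_def delta_def q_eq)

lemma gauss0_nontriv: "\<eta> \<noteq> \<epsilon> \<Longrightarrow> G0 \<eta> = G \<eta>"
  by (simp add: gauss0_def delta_def)

lemma gauss_scale:
  assumes \<eta>: "\<eta> \<in> mchars" and "c \<noteq> 0"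
  shows "(\<Sum>x\<in>UNIV. \<psi> (c * x) * \<eta> x) = - (inverse (\<eta> c) * G \<eta>)"
proof -
  have "\<eta> x = inverse (\<eta> c) * \<eta> (c * x)" for x
    using assms by (simp add: mchar_mult[OF \<eta>] mchar_eq_0_iff[OF \<eta>])
  then have "(\<Sum>x\<in>UNIV. \<psi> (c * x) * \<eta> x) = (\<Sum>x\<in>UNIV. inverse (\<eta> c) * (\<psi> (c * x) * \<eta> (c * x)))"
    by (intro sum.cong refl) (metis mult.left_commute)
  also have "\<dots> = inverse (\<eta> c) * (\<Sum>x\<in>UNIV. \<psi> x * \<eta> x)"
    using sum_scale[OF assms(2), of "\<lambda>x. \<psi> x * \<eta> x"] by (simp flip: sum_distrib_left)
  finally show ?thesis by (simp add: gauss_eq[OF \<eta>])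
qed

text \<open>Writing \<open>x = t * y\<close> leaves an additive character sum in \<open>y\<close>,
  which vanishes unless \<open>t = - 1\<close>. For the trivial character the factor
  \<open>q\<close> comes from \<open>G0\<close>, so the formula has no exception.\<close>

lemma gauss_reflection:
  assumes \<eta>: "\<eta> \<in> mchars"
  shows "G \<eta> * G0 (chinv \<eta>) = q * \<eta> (- 1)"
proof (cases "\<eta> = \<epsilon>")
  case True
  then show ?thesis by (simp add: triv_char_def[of "- 1"])
next
  case False
  have "G \<eta> * G0 (chinv \<eta>) = (\<Sum>x\<in>UNIV. \<psi> x * \<eta> x) * (\<Sum>y\<in>UNIV. \<psi> y * inverse (\<eta> y))"
    using False by (simp add: gauss0_nontriv \<eta> gauss_eq chinv_apply)
  also have "\<dots> = (\<Sum>y\<in>UNIV. \<Sum>x\<in>UNIV. \<psi> x * \<eta> x * (\<psi> y * inverse (\<eta> y)))"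
    unfolding sum_product by (rule sum.swap)
  also have "\<dots> = (\<Sum>y\<in>UNIV. \<Sum>t\<in>UNIV. \<eta> t * \<psi> ((1 + t) * y))"
  proof (rule sum.cong[OF refl])
    fix y :: 'a
    show "(\<Sum>x\<in>UNIV. \<psi> x * \<eta> x * (\<psi> y * inverse (\<eta> y))) = (\<Sum>t\<in>UNIV. \<eta> t * \<psi> ((1 + t) * y))"
    \<comment> \<open>The row \<open>y = 0\<close> is 0 on the left because
      \<open>inverse 0 = 0\<close>, and 0 on the right because a nontrivial character sums to 0. It
      can therefore be included, and the sum over \<open>y\<close> becomes complete.\<close>
    proof (cases "y = 0")
      case True
      then show ?thesis
        using sum_mchar[OF \<eta>] False by (simp add: mchar_0[OF \<eta>] psi_0)
    next
      case y: False
      have "\<psi> (y * t) * \<eta> (y * t) * (\<psi> y * inverse (\<eta> y)) = \<eta> t * \<psi> ((1 + t) * y)" for t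
        using y by (simp add: mchar_mult[OF \<eta>] mchar_eq_0_iff[OF \<eta>] distrib_right psi_add mult.commute[of t])
      then show ?thesis
        using sum_scale[OF y, of "\<lambda>x. \<psi> x * \<eta> x * (\<psi> y * inverse (\<eta> y))"] by simp
    qed
  qed
  also have "\<dots> = (\<Sum>t\<in>UNIV. \<eta> t * (\<Sum>y\<in>UNIV. \<psi> ((1 + t) * y)))"
    by (subst sum.swap) (simp add: sum_distrib_left)
  also have "\<dots> = (\<Sum>t\<in>UNIV. if t = (- 1 :: 'a) then \<eta> (- 1) * q else 0)"
    by (rule sum.cong[OF refl]) (auto simp: sum_psi add_eq_0_iff)
  finally show ?thesis by simp
qed

lemma gauss_neq_0 [simp]:
  assumes "\<eta> \<in> mchars" shows "G \<eta> \<noteq> 0"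
  using gauss_reflection[OF assms] by (auto simp: mchar_eq_0_iff[OF assms])

lemma gauss0_neq_0 [simp]:
  assumes "\<eta> \<in> mchars" shows "G0 \<eta> \<noteq> 0"
  using assms q_neq_0 by (simp add: gauss0_def q_eq)

section \<open>Kloosterman sums and their Mellin transforms\<close>

text \<open>This is the multiplicative convolution of \<open>a s * \<psi> s\<close> and
  \<open>b t * \<psi> t\<close>, a twisted Kloosterman sum. The term \<open>s = 0\<close> disappears
  for characters, since they vanish at 0.\<close>

definition kloosterman :: "('a \<Rightarrow> complex) \<Rightarrow> ('a \<Rightarrow> complex) \<Rightarrow> 'a \<Rightarrow> complex" where
  "kloosterman a b z = (\<Sum>s\<in>UNIV. a s * b (z / s) * \<psi> (s + z / s))"

lemma kloosterman_0:
  assumes "b \<in> mchars"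
  shows "kloosterman a b 0 = 0"
  by (simp add: kloosterman_def mchar_0[OF assms])

lemma kloosterman_commute:
  assumes "a \<in> mchars" "b \<in> mchars"
  shows "kloosterman a b z = kloosterman b a z"
proof (cases "z = 0")
  case False
  show ?thesis
    using sum_divide_swap[OF False, of "\<lambda>s. a s * b (z / s) * \<psi> (s + z / s)"] False
    unfolding kloosterman_def by (simp add: mult.commute add.commute)
qed (simp add: kloosterman_0 assms)

lemma kloosterman_twist:
  assumes "a \<in> mchars" "b \<in> mchars" "c \<in> mchars"
  shows "kloosterman (chmul a c) (chmul b c) z = c z * kloosterman a b z"
proof -
  have "chmul a c s * chmul b c (z / s) = c z * (a s * b (z / s))" for s
  proof (cases "s = 0")
    case False
    then have "c z = c s * c (z / s)" by (simp flip: mchar_mult[OF assms(3)])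
    then show ?thesis by (simp add: chmul_def)
  qed (simp add: chmul_def mchar_0[OF assms(1)])
  then show ?thesis
    by (simp add: kloosterman_def sum_distrib_left mult.assoc)
qed

text \<open>Mellin transforms turn multiplicative convolution into a product: the substitution
  \<open>z = s * t\<close> separates the two variables.\<close>

lemma kloosterman_mellin:
  assumes a: "a \<in> mchars" and b: "b \<in> mchars" and v: "v \<in> mchars"
  shows "(\<Sum>z\<in>UNIV. kloosterman a b z * v z) = G (chmul a v) * G (chmul b v)"
proof -
  have "(\<Sum>z\<in>UNIV. kloosterman a b z * v z) = (\<Sum>s\<in>UNIV. \<Sum>z\<in>UNIV. a s * b (z / s) * \<psi> (s + z / s) * v z)"
    unfolding kloosterman_def sum_distrib_right by (rule sum.swap)
  also have "\<dots> = (\<Sum>s\<in>UNIV. \<Sum>t\<in>UNIV. \<psi> s * (a s * v s) * (\<psi> t * (b t * v t)))"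
  proof (rule sum.cong[OF refl])
    fix s :: 'a
    show "(\<Sum>z\<in>UNIV. a s * b (z / s) * \<psi> (s + z / s) * v z) =
        (\<Sum>t\<in>UNIV. \<psi> s * (a s * v s) * (\<psi> t * (b t * v t)))"
    proof (cases "s = 0")
      case False
      have "(\<Sum>z\<in>UNIV. a s * b (z / s) * \<psi> (s + z / s) * v z) =
          (\<Sum>t\<in>UNIV. a s * b (s * t / s) * \<psi> (s + s * t / s) * v (s * t))"
        by (rule sum_scale[OF False, symmetric])
      then show ?thesis using False
        by (simp add: psi_add mchar_mult[OF v] mult_ac)
    qed (simp add: mchar_0[OF a])
  qed
  also have "\<dots> = G (chmul a v) * G (chmul b v)"
    unfolding gauss_eq[OF chmul_mchar[OF a v]] gauss_eq[OF chmul_mchar[OF b v]]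
    by (simp add: chmul_def sum_product)
  finally show ?thesis .
qed

text \<open>A finite field counterpart of a Bessel function: up to a constant, its Mellin
  coefficients are those of a 0F1 series with lower parameter \<open>c\<close>.\<close>

abbreviation J where "J c \<equiv> kloosterman (chinv c) \<epsilon>"

text \<open>Reflection replaces each reciprocal of \<open>G0\<close> by an ordinary Gauss sum of the
  inverse character. The sign \<open>\<nu> (- 1)\<close> arises twice and cancels, so only the sign
  \<open>c (- 1)\<close> stays in the constant.\<close>

lemma inverse_poch0:
  assumes c: "c \<in> mchars" and v: "\<nu> \<in> mchars"
  shows "1 / (poch0 \<psi> c \<nu> * poch0 \<psi> \<epsilon> \<nu>) = G0 c * c (- 1) / q * (\<Sum>w\<in>UNIV. J c w * chinv \<nu> w)"
proof -
  have *: "chinv \<eta> (- 1) = \<eta> (- 1)" if "\<eta> \<in> mchars" for \<eta> :: "'a \<Rightarrow> complex"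
    using that by (simp add: chinv_apply mchar_minus_1)
  have "G (chinv (chmul c \<nu>)) * G0 (chmul c \<nu>) = q * chinv (chmul c \<nu>) (- 1)"
    using gauss_reflection[of "chinv (chmul c \<nu>)"] c v by (simp del: chinv_chmul)
  then have 1: "G (chinv (chmul c \<nu>)) = q * (c (- 1) * \<nu> (- 1)) / G0 (chmul c \<nu>)"
    using c v by (simp del: chinv_chmul add: * field_simps) (simp add: chmul_def)
  have 2: "G (chinv \<nu>) = q * \<nu> (- 1) / G0 \<nu>"
    using gauss_reflection[of "chinv \<nu>"] v by (simp add: * field_simps)
  have "(\<Sum>w\<in>UNIV. J c w * chinv \<nu> w) = G (chinv (chmul c \<nu>)) * G (chinv \<nu>)"
    using c v by (simp add: kloosterman_mellin)
  also have "\<dots> = q * q * c (- 1) * (\<nu> (- 1) * \<nu> (- 1)) / (G0 (chmul c \<nu>) * G0 \<nu>)"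
    by (simp add: 1 2 del: chinv_chmul)
  finally have 3: "(\<Sum>w\<in>UNIV. J c w * chinv \<nu> w) = q * q * c (- 1) / (G0 (chmul c \<nu>) * G0 \<nu>)"
    using mchar_minus_1_square[OF v] by simp
  have "G0 c * c (- 1) / q * (q * q * c (- 1) / (G0 (chmul c \<nu>) * G0 \<nu>)) =
      (c (- 1) * c (- 1)) * (q * G0 c / (G0 (chmul c \<nu>) * G0 \<nu>))"
    by simp
  then show ?thesis
    using mchar_minus_1_square[OF c] c v by (simp add: 3 poch0_def)
qed

text \<open>Parseval: the Mellin coefficients of the three Kloosterman-type sums are products of Gauss
  sums, and these products are the coefficients of the hypergeometric series.\<close>

lemma F4_eq_kloosterman:
  assumes a: "a \<in> mchars" and b: "b \<in> mchars" and c: "c \<in> mchars" and d: "d \<in> mchars"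
  shows "F4 \<psi> a b c d x y = c (- 1) * d (- 1) * G0 c * G0 d / (q\<^sup>2 * G a * G b) *
    (\<Sum>z\<in>UNIV. kloosterman a b z * J c (x * z) * J d (y * z))"
proof -
  define C where "C = c (- 1) * d (- 1) * G0 c * G0 d / (q\<^sup>2 * G a * G b)"
  define H where "H e \<nu> = (\<Sum>w\<in>UNIV. J e w * chinv \<nu> w)" for e \<nu>
  have J0: "J e 0 = 0" for e by (simp add: kloosterman_0)
  have summand: "poch \<psi> a (chmul \<nu>1 \<nu>2) * poch \<psi> b (chmul \<nu>1 \<nu>2) /
        (poch0 \<psi> c \<nu>1 * poch0 \<psi> d \<nu>2 * poch0 \<psi> \<epsilon> \<nu>1 * poch0 \<psi> \<epsilon> \<nu>2) * \<nu>1 x * \<nu>2 y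
      = (\<Sum>z\<in>UNIV. C * kloosterman a b z * (H c \<nu>1 * \<nu>1 (x * z)) * (H d \<nu>2 * \<nu>2 (y * z)))"
    if v1: "\<nu>1 \<in> mchars" and v2: "\<nu>2 \<in> mchars" for \<nu>1 \<nu>2
  proof -
    have "poch \<psi> a (chmul \<nu>1 \<nu>2) * poch \<psi> b (chmul \<nu>1 \<nu>2) =
        (\<Sum>z\<in>UNIV. kloosterman a b z * chmul \<nu>1 \<nu>2 z) / (G a * G b)"
      using a b v1 v2 by (simp add: kloosterman_mellin poch_def)
    then have "poch \<psi> a (chmul \<nu>1 \<nu>2) * poch \<psi> b (chmul \<nu>1 \<nu>2) /
        (poch0 \<psi> c \<nu>1 * poch0 \<psi> d \<nu>2 * poch0 \<psi> \<epsilon> \<nu>1 * poch0 \<psi> \<epsilon> \<nu>2) * \<nu>1 x * \<nu>2 y =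
        (\<Sum>z\<in>UNIV. kloosterman a b z * chmul \<nu>1 \<nu>2 z) / (G a * G b) *
        (1 / (poch0 \<psi> c \<nu>1 * poch0 \<psi> \<epsilon> \<nu>1)) * (1 / (poch0 \<psi> d \<nu>2 * poch0 \<psi> \<epsilon> \<nu>2)) * \<nu>1 x * \<nu>2 y"
      by (simp add: mult_ac)
    also have "\<dots> = C * H c \<nu>1 * H d \<nu>2 * \<nu>1 x * \<nu>2 y * (\<Sum>z\<in>UNIV. kloosterman a b z * (\<nu>1 z * \<nu>2 z))"
      unfolding inverse_poch0[OF c v1] inverse_poch0[OF d v2] H_def[symmetric] C_def
      by (simp add: power2_eq_square chmul_def mult_ac)
    also have "\<dots> = (\<Sum>z\<in>UNIV. C * kloosterman a b z * (H c \<nu>1 * \<nu>1 (x * z)) * (H d \<nu>2 * \<nu>2 (y * z)))"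
      by (simp add: mchar_mult[OF v1] mchar_mult[OF v2] sum_distrib_left mult_ac)
    finally show ?thesis .
  qed
  have "(\<Sum>\<nu>1\<in>mchars. \<Sum>\<nu>2\<in>mchars. poch \<psi> a (chmul \<nu>1 \<nu>2) * poch \<psi> b (chmul \<nu>1 \<nu>2) /
        (poch0 \<psi> c \<nu>1 * poch0 \<psi> d \<nu>2 * poch0 \<psi> \<epsilon> \<nu>1 * poch0 \<psi> \<epsilon> \<nu>2) * \<nu>1 x * \<nu>2 y)
     = (\<Sum>\<nu>1\<in>mchars. \<Sum>\<nu>2\<in>mchars. \<Sum>z\<in>UNIV.
          C * kloosterman a b z * (H c \<nu>1 * \<nu>1 (x * z)) * (H d \<nu>2 * \<nu>2 (y * z)))"
    by (intro sum.cong refl) (rule summand)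
  also have "\<dots> = (\<Sum>z\<in>UNIV. \<Sum>\<nu>1\<in>mchars. \<Sum>\<nu>2\<in>mchars.
          C * kloosterman a b z * (H c \<nu>1 * \<nu>1 (x * z)) * (H d \<nu>2 * \<nu>2 (y * z)))"
    by (simp only: sum.swap[of _ UNIV mchars])
  also have "\<dots> = (\<Sum>z\<in>UNIV. C * kloosterman a b z * (\<Sum>\<nu>1\<in>mchars. H c \<nu>1 * \<nu>1 (x * z)) *
      (\<Sum>\<nu>2\<in>mchars. H d \<nu>2 * \<nu>2 (y * z)))"
    unfolding mult.assoc unfolding sum_product unfolding sum_distrib_left mult.assoc ..
  also have "\<dots> = (q - 1)\<^sup>2 * C * (\<Sum>z\<in>UNIV. kloosterman a b z * J c (x * z) * J d (y * z))"
    unfolding H_def mellin_inversion[of "J _", OF J0] q_eq[symmetric]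
    by (simp add: sum_distrib_left power2_eq_square mult_ac)
  finally show ?thesis
    using q_neq_1 unfolding F4_def C_def[symmetric] q_eq[symmetric]
    by (simp add: power2_commute[of 1])
qed


section \<open>Salie sums and the duplication formula\<close>

lemma four_neq_0: "(4::'a) \<noteq> 0"
  using two_neq_0 by (metis mult_2 mult_eq_0_iff numeral_Bit0)

text \<open>The fibre consists of the roots of t^2 - c t + 1, which are inverse to each other, and
  the discriminant is (c + 2)(c - 2). Without roots the discriminant is a nonsquare and the two
  terms cancel. With a root t, c + 2 and c - 2 equal (t + 1)^2/t and (t - 1)^2/t, so each term is
  \<open>\<phi> t\<close> unless it is 0; it is 0 exactly when t is -1 or 1, where the two roots
  coincide.\<close>

lemma sum_phi_fiber:
  "(\<Sum>t | t \<noteq> 0 \<and> t + 1 / t = c. \<phi> t) = \<phi> (c + 2) + \<phi> (c - 2)"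
proof (cases "\<exists>t. t \<noteq> 0 \<and> t + 1 / t = c")
  case False
  have "\<phi> ((c + 2) * (c - 2)) = - 1"
  proof -
    have "(c + 2) * (c - 2) \<noteq> y\<^sup>2" for y
    proof
      assume y: "(c + 2) * (c - 2) = y\<^sup>2"
      \<comment> \<open>A square root \<open>y\<close> of the discriminant would give this root by
        the quadratic formula. The next computation is scaled by 4 so that only \<open>2 * t\<close>
        enters.\<close>
      define t where "t = (c + y) / 2"
      have t2: "2 * t = c + y" using two_neq_0 by (simp add: t_def)
      have "4 * (t * t + 1 - c * t) = (2 * t) * (2 * t) + 4 - 2 * c * (2 * t)"
        by (simp add: algebra_simps)
      also have "\<dots> = y\<^sup>2 - (c + 2) * (c - 2)"
        unfolding t2 by (simp add: algebra_simps power2_eq_square)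
      finally have "4 * (t * t + 1 - c * t) = 0" using y by (simp only: diff_self)
      then have *: "t * t + 1 = c * t"
        by (simp only: mult_eq_0_iff four_neq_0) simp
      then have "t \<noteq> 0" by auto
      with * have "t + 1 / t = c" by (simp add: field_simps)
      with False \<open>t \<noteq> 0\<close> show False by blast
    qed
    moreover from this[of 0] have "(c + 2) * (c - 2) \<noteq> 0" by simp
    ultimately show ?thesis by (simp add: quad_char_def)
  qed
  then have "\<phi> (c + 2) * \<phi> (c - 2) = - 1"
    by (simp add: mchar_mult[OF phi_mchar])
  then have "\<phi> (c + 2) + \<phi> (c - 2) = 0"
    by (auto simp: quad_char_def split: if_splits)
  moreover have set: "{t. t \<noteq> 0 \<and> t + 1 / t = c} = {}" using False by blast
  ultimately show ?thesis unfolding set by simp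
next
  case True
  then obtain t where t: "t \<noteq> 0" "t + 1 / t = c" by blast
  have set: "{t. t \<noteq> 0 \<and> t + 1 / t = c} = {t, 1 / t}"
  proof -
    have "s = t \<or> s = 1 / t" if "s \<noteq> 0" "s + 1 / s = t + 1 / t" for s
    proof -
      have "(s - t) * (s * t - 1) = 0"
        using that t(1) by (simp add: field_simps)
      then have "s - t = 0 \<or> s * t = 1" by auto
      then show ?thesis using t(1) by (auto simp: nonzero_eq_divide_eq)
    qed
    then show ?thesis using t by (auto simp: add.commute)
  qed
  have sq: "\<phi> (x * x) = 1" if "x \<noteq> 0" for x
    using that by (auto simp: quad_char_def power2_eq_square)
  have p1: "\<phi> (c + 2) = (if t = - 1 then 0 else \<phi> t)"
  proof -
    have "c + 2 = t * ((t + 1) / t * ((t + 1) / t))"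
      using t by (simp add: field_simps flip: t(2))
    then have "\<phi> (c + 2) = \<phi> t * \<phi> ((t + 1) / t * ((t + 1) / t))"
      by (simp only: mchar_mult[OF phi_mchar, of t])
    then show ?thesis
      using sq[of "(t + 1) / t"] t(1) by (auto simp: mchar_0[OF phi_mchar] add_eq_0_iff2)
  qed
  have p2: "\<phi> (c - 2) = (if t = 1 then 0 else \<phi> t)"
  proof -
    have "c - 2 = t * ((t - 1) / t * ((t - 1) / t))"
      using t by (simp add: field_simps flip: t(2))
    then have "\<phi> (c - 2) = \<phi> t * \<phi> ((t - 1) / t * ((t - 1) / t))"
      by (simp only: mchar_mult[OF phi_mchar, of t])
    then show ?thesis
      using sq[of "(t - 1) / t"] t(1) by (auto simp: mchar_0[OF phi_mchar])
  qed
  have inv: "\<phi> (1 / t) = \<phi> t"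
    using mchar_inverse[OF phi_mchar, of t] by (auto simp: quad_char_def inverse_eq_divide)
  have m1: "(1::'a) \<noteq> - 1"
    using two_neq_0 by (metis add.right_inverse one_add_one)
  show ?thesis
  proof (cases "t = 1 \<or> t = - 1")
    case True
    then show ?thesis unfolding set p1 p2 using m1 by auto
  next
    case False
    then have "t \<noteq> 1 / t"
      using t(1) by (auto simp: field_simps square_eq_1_iff)
    then show ?thesis unfolding set p1 p2 using False by (simp add: inv)
  qed
qed

text \<open>A Salie sum is elementary: on the fibre over \<open>c = t + 1 / t\<close> the sum of the quadratic character
  is \<open>\<phi> (c + 2) + \<phi> (c - 2)\<close>, which leaves two Gauss sums.\<close>

lemma salie_square:
  assumes "v \<noteq> 0"
  shows "J \<phi> (v\<^sup>2) = - G \<phi> * (\<psi> (2 * v) + \<psi> (- (2 * v)))"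
proof -
  have "J \<phi> (v\<^sup>2) = (\<Sum>s\<in>UNIV. \<phi> s * \<epsilon> (v\<^sup>2 / s) * \<psi> (s + v\<^sup>2 / s))"
    by (simp add: kloosterman_def)
  also have "\<dots> = (\<Sum>t\<in>UNIV. \<phi> (v * t) * \<epsilon> (v\<^sup>2 / (v * t)) * \<psi> (v * t + v\<^sup>2 / (v * t)))"
    by (rule sum_scale[OF assms, symmetric])
  also have "\<dots> = (\<Sum>t\<in>UNIV. \<phi> v * (\<phi> t * \<psi> (v * (t + 1 / t))))"
  proof (rule sum.cong[OF refl])
    fix t :: 'a
    show "\<phi> (v * t) * \<epsilon> (v\<^sup>2 / (v * t)) * \<psi> (v * t + v\<^sup>2 / (v * t)) = \<phi> v * (\<phi> t * \<psi> (v * (t + 1 / t)))"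
      using assms by (cases "t = 0")
        (simp_all add: mchar_mult[OF phi_mchar] mchar_0[OF phi_mchar] triv_char_def power2_eq_square distrib_left)
  qed
  also have "\<dots> = \<phi> v * (\<Sum>t | t \<noteq> 0. \<phi> t * \<psi> (v * (t + 1 / t)))"
    unfolding sum_distrib_left[symmetric]
    by (intro arg_cong[of _ _ "\<lambda>x. _ * x"] sum.mono_neutral_right) (auto simp: mchar_0[OF phi_mchar])
  also have "(\<Sum>t | t \<noteq> 0. \<phi> t * \<psi> (v * (t + 1 / t))) =
      (\<Sum>c\<in>UNIV. \<Sum>t | t \<in> {t. t \<noteq> 0} \<and> t + 1 / t = c. \<phi> t * \<psi> (v * (t + 1 / t)))"
    by (rule sum.group[symmetric]) auto
  also have "\<dots> = (\<Sum>c\<in>UNIV. (\<Sum>t | t \<noteq> 0 \<and> t + 1 / t = c. \<phi> t) * \<psi> (v * c))"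
    unfolding sum_distrib_right by (intro sum.cong) auto
  also have "\<dots> = (\<Sum>c\<in>UNIV. \<psi> (v * c) * \<phi> (c + 2)) + (\<Sum>c\<in>UNIV. \<psi> (v * c) * \<phi> (c - 2))"
    unfolding sum_phi_fiber by (simp add: distrib_left sum.distrib mult.commute)
  also have "(\<Sum>c\<in>UNIV. \<psi> (v * c) * \<phi> (c + 2)) = (\<Sum>c\<in>UNIV. \<psi> (v * (c - 2)) * \<phi> c)"
    by (rule sum.reindex_bij_witness[where i = "\<lambda>c. c - 2" and j = "\<lambda>c. c + 2"]) auto
  also have "\<dots> = \<psi> (- (2 * v)) * (\<Sum>c\<in>UNIV. \<psi> (v * c) * \<phi> c)"
    by (simp add: sum_distrib_left mult_ac right_diff_distrib flip: psi_add)
  also have "(\<Sum>c\<in>UNIV. \<psi> (v * c) * \<phi> (c - 2)) = (\<Sum>c\<in>UNIV. \<psi> (v * (c + 2)) * \<phi> c)"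
    by (rule sum.reindex_bij_witness[where i = "\<lambda>c. c + 2" and j = "\<lambda>c. c - 2"]) auto
  also have "\<dots> = \<psi> (2 * v) * (\<Sum>c\<in>UNIV. \<psi> (v * c) * \<phi> c)"
    by (simp add: sum_distrib_left distrib_left psi_add mult_ac)
  also have "(\<Sum>c\<in>UNIV. \<psi> (v * c) * \<phi> c) = - (inverse (\<phi> v) * G \<phi>)"
    by (rule gauss_scale[OF phi_mchar assms])
  also have "\<phi> v * (\<psi> (- (2 * v)) * - (inverse (\<phi> v) * G \<phi>) + \<psi> (2 * v) * - (inverse (\<phi> v) * G \<phi>)) =
      - G \<phi> * (\<psi> (2 * v) + \<psi> (- (2 * v)))"
    using assms mchar_eq_0_iff[OF phi_mchar, of v] by (simp add: field_simps)
  finally show ?thesis .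
qed

text \<open>Twisting by \<phi> exchanges the two characters \<phi> and \<epsilon> of this
  Kloosterman sum, which is symmetric in them. Thus \<open>J \<phi>\<close> can be nonzero only at
  nonzero squares.\<close>

lemma salie_twist: "\<phi> z * J \<phi> z = J \<phi> z"
  using kloosterman_twist[of \<epsilon> \<phi> \<phi> z] kloosterman_commute[of \<phi> \<epsilon> z] by simp

lemma salie_nonsquare:
  assumes "\<And>v. z \<noteq> v\<^sup>2"
  shows "J \<phi> z = 0"
proof -
  have "\<phi> z = - 1" using assms assms[of 0] by (auto simp: quad_char_def)
  then show ?thesis using salie_twist[of z] by simp
qed

text \<open>Squaring is two-to-one onto the nonzero squares, and the two exponentials in
  \<open>salie_square\<close> are the contributions of the roots \<open>v\<close> and
  \<open>- v\<close>; nonsquares contribute nothing and \<open>z = 0\<close> is removed by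
  \<open>f 0 = 0\<close>. The gain is a phase linear in \<open>m\<close>.\<close>

lemma sum_salie:
  assumes "f 0 = 0" "m \<noteq> 0"
  shows "(\<Sum>z\<in>UNIV. f z * J \<phi> (m\<^sup>2 * z)) = - G \<phi> * (\<Sum>w\<in>UNIV. f (w\<^sup>2) * \<psi> (2 * m * w))"
proof -
  have fiber: "(\<Sum>w | w\<^sup>2 = z. f (w\<^sup>2) * \<psi> (2 * m * w)) * (- G \<phi>) = f z * J \<phi> (m\<^sup>2 * z)" for z
  proof (cases "z = 0")
    case True
    then show ?thesis using assms(1) by simp
  next
    case z: False
    show ?thesis
    proof (cases "\<exists>v. z = v\<^sup>2")
      case True
      then obtain v where v: "z = v\<^sup>2" by blast
      with z have "v \<noteq> 0" by auto
      then have "v \<noteq> - v"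
        using two_neq_0 by (metis add_eq_0_iff2 mult_2 mult_eq_0_iff)
      have roots: "{w. w\<^sup>2 = z} = {v, - v}" by (auto simp: v power2_eq_iff)
      have J: "J \<phi> (m\<^sup>2 * z) = - G \<phi> * (\<psi> (2 * m * v) + \<psi> (- (2 * m * v)))"
        using salie_square[of "m * v"] \<open>v \<noteq> 0\<close> assms(2) by (simp add: v power_mult_distrib mult.assoc)
      show ?thesis
        unfolding J roots using \<open>v \<noteq> - v\<close> by (simp add: v[symmetric]) (simp add: algebra_simps)
    next
      case False
      then have roots: "{w. w\<^sup>2 = z} = {}" by auto
      have "m\<^sup>2 * z \<noteq> v\<^sup>2" for v
      proof
        assume "m\<^sup>2 * z = v\<^sup>2"
        then have "z = (v / m)\<^sup>2" using assms(2) by (simp add: field_simps)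
        then show False using False by blast
      qed
      then show ?thesis unfolding roots using salie_nonsquare[of "m\<^sup>2 * z"] by simp
    qed
  qed
  have "(\<Sum>z\<in>UNIV. f z * J \<phi> (m\<^sup>2 * z)) =
      (\<Sum>z\<in>UNIV. \<Sum>w | w \<in> UNIV \<and> w\<^sup>2 = z. f (w\<^sup>2) * \<psi> (2 * m * w)) * (- G \<phi>)"
    unfolding fiber[symmetric] sum_distrib_right[symmetric] by simp
  also have "(\<Sum>z\<in>UNIV. \<Sum>w | w \<in> UNIV \<and> w\<^sup>2 = z. f (w\<^sup>2) * \<psi> (2 * m * w)) =
      (\<Sum>w\<in>UNIV. f (w\<^sup>2) * \<psi> (2 * m * w))"
    by (rule sum.group) auto
  finally show ?thesis by simp
qed

text \<open>The Mellin transform of the Salie sum formula.\<close>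

lemma hasse_davenport_2:
  assumes \<eta>: "\<eta> \<in> mchars"
  shows "G \<eta> * G (chmul \<eta> \<phi>) * \<eta> 4 = G (chmul \<eta> \<eta>) * G \<phi>"
proof -
  have "G (chmul \<eta> \<phi>) * G \<eta> = (\<Sum>z\<in>UNIV. \<eta> z * J \<phi> (1\<^sup>2 * z))"
    using kloosterman_mellin[of \<phi> \<epsilon> \<eta>] \<eta> by (simp add: mult.commute chmul_commute)
  also have "\<dots> = - G \<phi> * (\<Sum>w\<in>UNIV. \<psi> (2 * w) * chmul \<eta> \<eta> w)"
    by (subst sum_salie) (simp_all add: mchar_0[OF \<eta>] chmul_def power2_eq_square mchar_mult[OF \<eta>] mult_ac)
  also have "\<dots> = G \<phi> * inverse (\<eta> 2 * \<eta> 2) * G (chmul \<eta> \<eta>)"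
    by (subst gauss_scale) (simp_all add: two_neq_0 \<eta>, simp add: chmul_def)
  also have "\<eta> 2 * \<eta> 2 = \<eta> 4"
    by (simp flip: mchar_mult[OF \<eta>])
  finally have *: "G (chmul \<eta> \<phi>) * G \<eta> = G \<phi> * inverse (\<eta> 4) * G (chmul \<eta> \<eta>)" .
  have "\<eta> 4 \<noteq> 0" by (simp add: mchar_eq_0_iff[OF \<eta>] four_neq_0)
  then show ?thesis using * by (simp add: field_simps)
qed

lemma gauss_phi_square: "G \<phi> * G \<phi> = q * \<phi> (- 1)"
  using gauss_reflection[OF phi_mchar] by (simp add: gauss0_nontriv)

section \<open>Jacobi sums and the Mellin transform of T\<close>

text \<open>The product of Gauss sums is sorted by \<open>s = x + y\<close>; the row
  \<open>s = 0\<close> contributes only if \<open>chmul a b\<close> is trivial, and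
  \<open>G0\<close> absorbs this unless both characters are trivial. In that case the sum is q - 2 =
  (q - 1)^2/q - 1/q, which explains the correction.\<close>

lemma jacobi_sum:
  assumes a: "a \<in> mchars" and b: "b \<in> mchars"
  shows "(\<Sum>t\<in>UNIV. a t * b (1 - t)) =
    (if a = \<epsilon> \<and> b = \<epsilon> then (q - 1)\<^sup>2 / q else 0) - G a * G b / G0 (chmul a b)"
proof -
  define S where "S = (\<Sum>t\<in>UNIV. a t * b (1 - t))"
  have "G a * G b = (\<Sum>x\<in>UNIV. \<Sum>y\<in>UNIV. \<psi> (x + y) * (a x * b y))"
    by (simp add: gauss_eq a b sum_product psi_add mult_ac)
  also have "\<dots> = (\<Sum>x\<in>UNIV. \<Sum>s\<in>UNIV. \<psi> s * (a x * b (s - x)))"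
  proof (rule sum.cong[OF refl])
    fix x
    show "(\<Sum>y\<in>UNIV. \<psi> (x + y) * (a x * b y)) = (\<Sum>s\<in>UNIV. \<psi> s * (a x * b (s - x)))"
      by (rule sum.reindex_bij_witness[where i = "\<lambda>s. s - x" and j = "\<lambda>y. x + y"]) auto
  qed
  also have "\<dots> = (\<Sum>s\<in>UNIV. \<psi> s * (\<Sum>x\<in>UNIV. a x * b (s - x)))"
    by (subst sum.swap) (simp add: sum_distrib_left)
  also have "\<dots> = (\<Sum>s\<in>UNIV. \<psi> s * chmul a b s * S + (if s = 0 then b (- 1) * (\<Sum>x\<in>UNIV. chmul a b x) else 0))"
  proof (rule sum.cong[OF refl])
    fix s :: 'a
    show "\<psi> s * (\<Sum>x\<in>UNIV. a x * b (s - x)) =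
      \<psi> s * chmul a b s * S + (if s = 0 then b (- 1) * (\<Sum>x\<in>UNIV. chmul a b x) else 0)"
    proof (cases "s = 0")
      case True
      have "a x * b (- x) = b (- 1) * chmul a b x" for x
        using mchar_minus[OF b, of x] by (simp add: chmul_def)
      then show ?thesis
        using True by (simp add: psi_0 mchar_0[OF chmul_mchar[OF a b]] sum_distrib_left)
    next
      case False
      have "(\<Sum>x\<in>UNIV. a x * b (s - x)) = (\<Sum>t\<in>UNIV. a (s * t) * b (s - s * t))"
        by (rule sum_scale[OF False, symmetric])
      also have "\<dots> = (\<Sum>t\<in>UNIV. chmul a b s * (a t * b (1 - t)))"
      proof (rule sum.cong[OF refl])
        fix t :: 'a
        have "b (s - s * t) = b s * b (1 - t)"
          by (simp add: right_diff_distrib flip: mchar_mult[OF b])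
        then show "a (s * t) * b (s - s * t) = chmul a b s * (a t * b (1 - t))"
          by (simp add: mchar_mult[OF a] chmul_def)
      qed
      finally show ?thesis using False by (simp add: S_def sum_distrib_left mult.assoc)
    qed
  qed
  also have "\<dots> = - G (chmul a b) * S + b (- 1) * (\<Sum>x\<in>UNIV. chmul a b x)"
    by (simp add: sum.distrib gauss_eq[OF chmul_mchar[OF a b]] flip: sum_distrib_right)
  finally have main: "G a * G b = - G (chmul a b) * S + b (- 1) * (if chmul a b = \<epsilon> then q - 1 else 0)"
    using sum_mchar[OF chmul_mchar[OF a b]] by (simp add: q_eq)
  show ?thesis
  proof (cases "chmul a b = \<epsilon>")
    case False
    then have "\<not> (a = \<epsilon> \<and> b = \<epsilon>)" by auto
    then show ?thesis
      using main False gauss_neq_0[OF chmul_mchar[OF a b]]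
      by (auto simp: gauss0_nontriv field_simps simp flip: S_def)
  next
    case ab: True
    show ?thesis
    proof (cases "a = \<epsilon>")
      case True
      then have "b = \<epsilon>" using ab b by simp
      then have S: "S = q - 2" using main True by (simp add: triv_char_def[of "- 1"] algebra_simps)
      then show ?thesis unfolding S_def[symmetric] S using True \<open>b = \<epsilon>\<close>
        by (simp add: field_simps power2_eq_square)
    next
      case False
      have "b = chinv a"
        using ab a b by (metis chmul_chinv_cancel(2) chmul_triv(1) chinv_mchar)
      moreover from this have "b \<noteq> \<epsilon>" using False a by simp
      ultimately have "G a * G b = q * a (- 1)"
        using gauss_reflection[OF a] by (simp add: gauss0_nontriv)
      moreover have "b (- 1) = a (- 1)"
        using \<open>b = chinv a\<close> by (simp add: chinv_apply[OF a] mchar_minus_1[OF a])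
      ultimately have "S = - a (- 1)" using main ab by (simp add: algebra_simps eq_neg_iff_add_eq_0)
      then show ?thesis using \<open>G a * G b = q * a (- 1)\<close> False ab by (simp flip: S_def)
    qed
  qed
qed

text \<open>By \<open>t + 1 / t - 2 = (t - 1)\<^sup>2 / t\<close>, these are the Kloosterman-type sums at squares, up to a
  factor of absolute value 1.\<close>

definition T :: "('a \<Rightarrow> complex) \<Rightarrow> 'a \<Rightarrow> complex" where
  "T \<theta> w = (\<Sum>t\<in>UNIV. \<theta> t * \<psi> (w * (t - 1)\<^sup>2 / t))"

text \<open>Summing over \<open>w\<close> first leaves a Jacobi sum of
  \<open>chmul \<theta> \<chi>\<close> and the inverse square of \<open>\<chi>\<close>. Duplication
  splits the Gauss sum of that square, and reflection removes \<open>G \<chi>\<close>. The excluded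
  pair is the one where the Jacobi sum has an uncompensated correction.\<close>

lemma T_mellin:
  assumes \<theta>: "\<theta> \<in> mchars" and \<chi>: "\<chi> \<in> mchars" and "\<not> (\<theta> = \<phi> \<and> \<chi> = \<phi>)"
  shows "(\<Sum>w\<in>UNIV. T \<theta> w * \<chi> w) = q * \<chi> (- 1) * G (chmul \<theta> \<chi>) * G (chmul (chinv \<chi>) \<phi>) /
    (\<chi> 4 * G \<phi> * G0 (chmul \<theta> (chinv \<chi>)))"
proof -
  let ?\<chi>2 = "chmul (chinv \<chi>) (chinv \<chi>)"
  have "(\<Sum>w\<in>UNIV. T \<theta> w * \<chi> w) = (\<Sum>t\<in>UNIV. \<theta> t * (\<Sum>w\<in>UNIV. \<psi> ((t - 1)\<^sup>2 / t * w) * \<chi> w))"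
    unfolding T_def sum_distrib_right by (subst sum.swap) (simp add: sum_distrib_left mult_ac)
  \<comment> \<open>At \<open>t = 1\<close> the phase is constant, so the inner sum is that of
    \<open>\<chi>\<close> itself, while the Jacobi summand is 0 there.\<close>
  also have "\<dots> = (\<Sum>t\<in>UNIV. (if t = 1 then \<Sum>w\<in>UNIV. \<chi> w else 0) - G \<chi> * (chmul \<theta> \<chi> t * ?\<chi>2 (1 - t)))"
  proof (rule sum.cong[OF refl])
    fix t :: 'a
    consider "t = 0" | "t = 1" | "t \<noteq> 0" "t \<noteq> 1" by blast
    then show "\<theta> t * (\<Sum>w\<in>UNIV. \<psi> ((t - 1)\<^sup>2 / t * w) * \<chi> w) =
      (if t = 1 then \<Sum>w\<in>UNIV. \<chi> w else 0) - G \<chi> * (chmul \<theta> \<chi> t * ?\<chi>2 (1 - t))"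
    proof cases
      case 1
      then show ?thesis by (simp add: mchar_0[OF \<theta>] chmul_def)
    next
      case 2
      then show ?thesis by (simp add: mchar_1[OF \<theta>] chmul_def psi_0 chinv_def)
    next
      case 3
      have sq: "(t - 1)\<^sup>2 / t = (1 - t) * (1 - t) * inverse t"
        by (simp add: power2_eq_square divide_inverse algebra_simps)
      have "inverse (\<chi> ((t - 1)\<^sup>2 / t)) = \<chi> t * (inverse (\<chi> (1 - t)) * inverse (\<chi> (1 - t)))"
        unfolding sq by (simp add: mchar_inverse[OF \<chi>] mchar_mult[OF \<chi>])
      then show ?thesis using 3
        by (subst gauss_scale[OF \<chi>]) (simp_all add: chmul_def chinv_apply[OF \<chi>])
    qed
  qed
  also have "\<dots> = (if \<chi> = \<epsilon> then q - 1 else 0) - G \<chi> * (\<Sum>t\<in>UNIV. chmul \<theta> \<chi> t * ?\<chi>2 (1 - t))"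
    using sum_mchar[OF \<chi>] by (simp add: sum_subtractf q_eq flip: sum_distrib_left)
  finally have main: "(\<Sum>w\<in>UNIV. T \<theta> w * \<chi> w) = (if \<chi> = \<epsilon> then q - 1 else 0) -
      G \<chi> * (\<Sum>t\<in>UNIV. chmul \<theta> \<chi> t * ?\<chi>2 (1 - t))" .
  show ?thesis
  proof (cases "\<chi> = \<epsilon>")
    case True
    have e: "\<epsilon> (4::'a) = 1" "\<epsilon> (-1::'a) = 1" by (simp_all add: triv_char_def four_neq_0)
    have "(\<Sum>w\<in>UNIV. T \<theta> w * \<chi> w) = (q - 1) - (\<Sum>t\<in>UNIV. \<theta> t * \<epsilon> (1 - t))"
      using main True \<theta> by simp
    \<comment> \<open>The value is 1 for trivial \<open>\<theta>\<close> and \<open>q\<close>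
      otherwise: the term from \<open>t = 1\<close> compensates the correction in the Jacobi
      sum.\<close>
    also have "\<dots> = q * G \<theta> / G0 \<theta>"
      unfolding jacobi_sum[OF \<theta> triv_char_mchar]
      by (cases "\<theta> = \<epsilon>") (simp_all add: gauss0_nontriv \<theta> power2_eq_square field_simps)
    finally show ?thesis using True \<theta> e by simp
  next
    case False
    \<comment> \<open>Both Jacobi characters trivial means that \<open>\<chi>\<close> has order 2
      and \<open>\<theta>\<close> is its inverse, hence both are \<phi>.\<close>
    have n: "\<not> (chmul \<theta> \<chi> = \<epsilon> \<and> ?\<chi>2 = \<epsilon>)"
    proof
      assume *: "chmul \<theta> \<chi> = \<epsilon> \<and> ?\<chi>2 = \<epsilon>"
      then have "chinv \<chi> = \<phi>"
        using mchar_square_eq_triv[OF two_neq_0, of "chinv \<chi>"] \<chi> False by auto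
      then have c: "\<chi> = \<phi>" using chinv_chinv[OF \<chi>] by simp
      then have "\<theta> = \<phi>"
        using * \<theta> by (metis chmul_assoc chmul_triv quad_char_square phi_mchar)
      with c assms(3) show False by blast
    qed
    have r: "chmul (chmul \<theta> \<chi>) ?\<chi>2 = chmul \<theta> (chinv \<chi>)"
      using \<theta> \<chi> by (simp add: chmul_assoc)
    have inv4: "chinv \<chi> 4 = inverse (\<chi> 4)" by (simp add: chinv_apply[OF \<chi>])
    have hd: "G (chinv \<chi>) * G (chmul (chinv \<chi>) \<phi>) / (\<chi> 4 * G \<phi>) = G ?\<chi>2"
      using hasse_davenport_2[of "chinv \<chi>"] \<chi> mchar_eq_0_iff[OF \<chi>, of 4] four_neq_0 gauss_neq_0[OF phi_mchar]
      by (simp add: inv4 field_simps)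
    have refl': "G \<chi> * G (chinv \<chi>) = q * \<chi> (- 1)"
      using gauss_reflection[OF \<chi>] False \<chi> by (simp add: gauss0_nontriv)
    have "(\<Sum>w\<in>UNIV. T \<theta> w * \<chi> w) = G \<chi> * (G (chmul \<theta> \<chi>) * G ?\<chi>2 / G0 (chmul \<theta> (chinv \<chi>)))"
      using main False n \<theta> \<chi> jacobi_sum[of "chmul \<theta> \<chi>" ?\<chi>2] unfolding r by auto
    also have "\<dots> = (G \<chi> * G (chinv \<chi>)) * G (chmul \<theta> \<chi>) * G (chmul (chinv \<chi>) \<phi>) /
        (\<chi> 4 * G \<phi> * G0 (chmul \<theta> (chinv \<chi>)))"
      unfolding hd[symmetric] by simp
    finally show ?thesis unfolding refl' .
  qed
qed


section \<open>Transformations of F4\<close>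

text \<open>The twist leaves the sum over \<open>z\<close> unchanged, so the two sides differ only
  in the Gauss sums in the denominator of the prefactor; their quotients are the two
  \<open>poch\<close> factors.\<close>

lemma F4_phi_twist:
  assumes a: "\<alpha> \<in> mchars" and b: "\<beta> \<in> mchars" and c: "c \<in> mchars"
  shows "F4 \<psi> \<alpha> \<beta> c \<phi> x (m\<^sup>2) = poch \<psi> \<alpha> \<phi> * poch \<psi> \<beta> \<phi> *
    F4 \<psi> (chmul \<alpha> \<phi>) (chmul \<beta> \<phi>) c \<phi> x (m\<^sup>2)"
proof -
  have tw: "\<phi> z * J \<phi> (m\<^sup>2 * z) = J \<phi> (m\<^sup>2 * z)" for z
  proof (cases "m = 0")
    case True
    then show ?thesis by (simp add: kloosterman_0)
  next
    case False
    then have "\<phi> (m\<^sup>2) = 1" by (auto simp: quad_char_def)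
    then have "\<phi> (m\<^sup>2 * z) = \<phi> z" by (simp add: mchar_mult[OF phi_mchar])
    then show ?thesis using salie_twist[of "m\<^sup>2 * z"] by simp
  qed
  have eq: "kloosterman (chmul \<alpha> \<phi>) (chmul \<beta> \<phi>) z * J c (x * z) * J \<phi> (m\<^sup>2 * z) =
      kloosterman \<alpha> \<beta> z * J c (x * z) * J \<phi> (m\<^sup>2 * z)" for z
    using tw[of z] by (auto simp: kloosterman_twist[OF a b phi_mchar] mult.commute mult.left_commute)
  show ?thesis
    unfolding F4_eq_kloosterman[OF a b c phi_mchar]
      F4_eq_kloosterman[OF chmul_mchar[OF a phi_mchar] chmul_mchar[OF b phi_mchar] c phi_mchar] eq
    using a b by (simp add: poch_def mult_ac)
qed

text \<open>The sum on the right is the one that represents F4 with parameters \<alpha>, \<beta>;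
  \<open>c\<close>, \<phi> at \<open>x\<close>, \<open>m\<^sup>2\<close>. So (ii) becomes a
  comparison of constants and (iii) an evaluation of this sum. The inverse square of \<alpha> at
  \<open>m\<close> undoes the factor \<open>\<alpha> (m\<^sup>2)\<close> produced by the
  scaling.\<close>

lemma F4_inversion:
  assumes a: "\<alpha> \<in> mchars" and b: "\<beta> \<in> mchars" and c: "c \<in> mchars" and m: "m \<noteq> 0"
  shows "chmul (chinv \<alpha>) (chinv \<alpha>) m * F4 \<psi> \<alpha> (chmul \<alpha> \<phi>) c (chmul \<alpha> (chinv \<beta>)) (x / m\<^sup>2) (1 / m\<^sup>2) =
    c (- 1) * chmul \<alpha> (chinv \<beta>) (- 1) * G0 c * G0 (chmul \<alpha> (chinv \<beta>)) / (q\<^sup>2 * G \<alpha> * G (chmul \<alpha> \<phi>)) *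
    (\<Sum>z\<in>UNIV. kloosterman \<alpha> \<beta> z * J c (x * z) * J \<phi> (m\<^sup>2 * z))"
proof -
  let ?d = "chmul \<alpha> (chinv \<beta>)"
  have d: "?d \<in> mchars" using a b by simp
  have 1: "kloosterman \<alpha> (chmul \<alpha> \<phi>) z = \<alpha> z * J \<phi> z" for z
    using kloosterman_twist[OF triv_char_mchar phi_mchar a, of z] kloosterman_commute[OF phi_mchar triv_char_mchar, of z] a
    by (simp add: chmul_commute)
  have 2: "\<alpha> z * J ?d z = kloosterman \<alpha> \<beta> z" for z
  proof -
    have "kloosterman (chmul (chinv ?d) \<alpha>) (chmul \<epsilon> \<alpha>) z = \<alpha> z * J ?d z"
      by (rule kloosterman_twist) (use a b in auto)
    moreover have "chmul (chinv ?d) \<alpha> = \<beta>"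
      using a b by (simp add: chmul_assoc chmul_commute[of \<beta>])
    ultimately show ?thesis using a b by (simp add: kloosterman_commute)
  qed
  have "(\<Sum>z\<in>UNIV. kloosterman \<alpha> (chmul \<alpha> \<phi>) z * J c (x / m\<^sup>2 * z) * J ?d (1 / m\<^sup>2 * z)) =
      (\<Sum>z\<in>UNIV. kloosterman \<alpha> (chmul \<alpha> \<phi>) (m\<^sup>2 * z) * J c (x / m\<^sup>2 * (m\<^sup>2 * z)) * J ?d (1 / m\<^sup>2 * (m\<^sup>2 * z)))"
    by (rule sum_scale[symmetric]) (use m in simp)
  \<comment> \<open>The kernels trade roles: the first Kloosterman sum supplies
    \<open>J \<phi> (m\<^sup>2 * z)\<close>, and its factor \<open>\<alpha> z\<close> turns
    \<open>J ?d z\<close> into \<open>kloosterman \<alpha> \<beta> z\<close>.\<close>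
  also have "\<dots> = (\<Sum>z\<in>UNIV. \<alpha> (m\<^sup>2) * (kloosterman \<alpha> \<beta> z * J c (x * z) * J \<phi> (m\<^sup>2 * z)))"
    using m unfolding 1 2[symmetric] by (simp add: mchar_mult[OF a] mult_ac)
  finally have 3: "(\<Sum>z\<in>UNIV. kloosterman \<alpha> (chmul \<alpha> \<phi>) z * J c (x / m\<^sup>2 * z) * J ?d (1 / m\<^sup>2 * z)) =
      \<alpha> (m\<^sup>2) * (\<Sum>z\<in>UNIV. kloosterman \<alpha> \<beta> z * J c (x * z) * J \<phi> (m\<^sup>2 * z))"
    by (simp only: sum_distrib_left)
  have 4: "chmul (chinv \<alpha>) (chinv \<alpha>) m * \<alpha> (m\<^sup>2) = 1"
    using m by (simp add: chmul_def chinv_apply[OF a] mchar_mult[OF a] power2_eq_square mchar_eq_0_iff[OF a] field_simps)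
  show ?thesis
    unfolding F4_eq_kloosterman[OF a chmul_mchar[OF a phi_mchar] c d] 3
    using 4 by (simp add: mult.left_commute[of "chmul (chinv \<alpha>) (chinv \<alpha>) m"] mult.commute[of "\<alpha> (m\<^sup>2)"])
qed

lemma gauss_chinv:
  assumes "\<eta> \<in> mchars"
  shows "G (chinv \<eta>) = q * \<eta> (- 1) / G0 \<eta>" "G0 (chinv \<eta>) = q * \<eta> (- 1) / G \<eta>"
proof -
  have "chinv \<eta> (- 1) = \<eta> (- 1)"
    using assms by (simp add: chinv_apply mchar_minus_1)
  then show "G (chinv \<eta>) = q * \<eta> (- 1) / G0 \<eta>" "G0 (chinv \<eta>) = q * \<eta> (- 1) / G \<eta>"
    using gauss_reflection[of \<eta>] gauss_reflection[of "chinv \<eta>"] assms by (simp_all add: field_simps)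
qed

lemma F4_eq_F4_inverted:
  assumes a: "\<alpha> \<in> mchars" and b: "\<beta> \<in> mchars" and c: "c \<in> mchars" and m: "m \<noteq> 0"
  shows "F4 \<psi> \<alpha> \<beta> c \<phi> x (m\<^sup>2) =
    G (chmul (chinv \<alpha>) \<beta>) * G (chmul \<alpha> \<phi>) / (G \<beta> * G \<phi>) * chmul (chinv \<alpha>) (chinv \<alpha>) m *
    F4 \<psi> \<alpha> (chmul \<alpha> \<phi>) c (chmul \<alpha> (chinv \<beta>)) (x / m\<^sup>2) (1 / m\<^sup>2)"
proof -
  let ?d = "chmul \<alpha> (chinv \<beta>)" and ?e = "chmul (chinv \<alpha>) \<beta>"
  have d: "?d \<in> mchars" "?e \<in> mchars" using a b by auto
  have e: "chinv ?e = ?d" using a b by simp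
  have s: "?e (- 1) = ?d (- 1)"
    by (simp add: chmul_def chinv_apply[OF a] chinv_apply[OF b] mchar_minus_1[OF a] mchar_minus_1[OF b])
  have 1: "G0 ?d = q * ?d (- 1) / G ?e"
    using gauss_chinv(2)[OF d(2)] unfolding e s .
  have 2: "?d (- 1) * ?d (- 1) = 1" by (rule mchar_minus_1_square[OF d(1)])
  \<comment> \<open>The prefactor from \<open>F4_eq_kloosterman\<close> has
    \<open>\<phi> (- 1) * G0 \<phi>\<close> upstairs, the target \<open>G \<phi>\<close> downstairs;
    the square of the quadratic Gauss sum converts one into the other.\<close>
  have 3: "\<phi> (- 1) = q / (G \<phi> * G \<phi>)"
    using mchar_minus_1[OF phi_mchar] unfolding gauss_phi_square by (simp add: divide_inverse)
  define S where "S = (\<Sum>z\<in>UNIV. kloosterman \<alpha> \<beta> z * J c (x * z) * J \<phi> (m\<^sup>2 * z))"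
  have "G ?e * G (chmul \<alpha> \<phi>) / (G \<beta> * G \<phi>) * chmul (chinv \<alpha>) (chinv \<alpha>) m *
      F4 \<psi> \<alpha> (chmul \<alpha> \<phi>) c ?d (x / m\<^sup>2) (1 / m\<^sup>2) =
      G ?e * G (chmul \<alpha> \<phi>) / (G \<beta> * G \<phi>) *
      (c (- 1) * ?d (- 1) * G0 c * (q * ?d (- 1) / G ?e) / (q\<^sup>2 * G \<alpha> * G (chmul \<alpha> \<phi>)) * S)"
    unfolding mult.assoc F4_inversion[OF a b c m, unfolded mult.assoc] 1 S_def ..
  also have "\<dots> = (?d (- 1) * ?d (- 1)) * (c (- 1) * G0 c / (q * G \<alpha> * G \<beta> * G \<phi>) * S)"
    using a d by (simp add: power2_eq_square mult_ac)
  also have "\<dots> = F4 \<psi> \<alpha> \<beta> c \<phi> x (m\<^sup>2)"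
    unfolding 2 F4_eq_kloosterman[OF a b c phi_mchar] S_def[symmetric] 3
    by (simp add: gauss0_nontriv power2_eq_square)
  finally show ?thesis ..
qed

section \<open>Evaluation as a 3F2 series\<close>

text \<open>With \<open>s = w * t\<close> the exponent w (t + 1/t) - 2 w is a perfect square over t
  times w, and the characters factor into a part in \<open>w\<close> and a part in
  \<open>t\<close>.\<close>

lemma kloosterman_square:
  assumes a: "a \<in> mchars" and b: "b \<in> mchars"
  shows "kloosterman a b (w\<^sup>2) * \<psi> (- (2 * w)) = chmul a b w * T (chmul a (chinv b)) w"
proof (cases "w = 0")
  case True
  then show ?thesis by (simp add: kloosterman_0[OF b] chmul_def mchar_0[OF a])
next
  case False
  have "kloosterman a b (w\<^sup>2) = (\<Sum>t\<in>UNIV. a (w * t) * b (w\<^sup>2 / (w * t)) * \<psi> (w * t + w\<^sup>2 / (w * t)))"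
    unfolding kloosterman_def by (rule sum_scale[OF False, symmetric])
  then have "kloosterman a b (w\<^sup>2) * \<psi> (- (2 * w)) =
      (\<Sum>t\<in>UNIV. a (w * t) * b (w\<^sup>2 / (w * t)) * (\<psi> (w * t + w\<^sup>2 / (w * t)) * \<psi> (- (2 * w))))"
    by (simp only: sum_distrib_right mult.assoc)
  also have "\<dots> = (\<Sum>t\<in>UNIV. chmul a b w * (chmul a (chinv b) t * \<psi> (w * (t - 1)\<^sup>2 / t)))"
  proof (rule sum.cong[OF refl])
    fix t :: 'a
    show "a (w * t) * b (w\<^sup>2 / (w * t)) * (\<psi> (w * t + w\<^sup>2 / (w * t)) * \<psi> (- (2 * w))) =
      chmul a b w * (chmul a (chinv b) t * \<psi> (w * (t - 1)\<^sup>2 / t))"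
    proof (cases "t = 0")
      case t: False
      have "w * t + w\<^sup>2 / (w * t) + - (2 * w) = w * (t - 1)\<^sup>2 / t"
        using False t by (simp add: field_simps power2_eq_square)
      then have "\<psi> (w * t + w\<^sup>2 / (w * t)) * \<psi> (- (2 * w)) = \<psi> (w * (t - 1)\<^sup>2 / t)"
        by (simp only: psi_add[symmetric])
      moreover have "w\<^sup>2 / (w * t) = w * inverse t"
        using False t by (simp add: field_simps power2_eq_square)
      ultimately show ?thesis
        by (simp add: chmul_def chinv_apply[OF b] mchar_mult[OF a] mchar_mult[OF b] mchar_inverse[OF b])
    qed (simp add: chmul_def mchar_0[OF a])
  qed
  finally show ?thesis by (simp add: T_def sum_distrib_left)
qed

lemma chmul_quotient_product:
  assumes a: "a \<in> mchars" and b: "b \<in> mchars"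
  shows "chmul (chmul a (chinv b)) (chmul (chmul a b) v) = chmul (chmul a a) v"
proof
  fix x
  show "chmul (chmul a (chinv b)) (chmul (chmul a b) v) x = chmul (chmul a a) v x"
    by (cases "x = 0")
      (simp_all add: chmul_def chinv_apply[OF b] mchar_0[OF a] mchar_eq_0_iff[OF b])
qed

lemma chmul_phi_cancel [simp]: "\<eta> \<in> mchars \<Longrightarrow> chmul \<phi> (chmul \<phi> \<eta>) = \<eta>"
  by (simp flip: chmul_assoc)

text \<open>The first sum supplies the parameter \<gamma> and the lower parameters \<epsilon>,
  \<gamma>^2 of the 3F2; the second supplies \<alpha>^2, \<beta>^2 and the lower parameter
  \<alpha>\<beta>\<phi>. In their product the values \<open>\<nu> 4\<close> cancel.\<close>

lemma mellin_coefficients: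
  assumes a: "\<alpha> \<in> mchars" and b: "\<beta> \<in> mchars" and c: "\<gamma> \<in> mchars" and v: "\<nu> \<in> mchars"
    and ab: "chmul (chmul \<alpha> (chinv \<beta>)) \<phi> \<noteq> \<epsilon>" and c1: "\<gamma> \<noteq> \<epsilon>"
  shows "(\<Sum>w\<in>UNIV. T (chinv (chmul \<gamma> \<phi>)) w * chmul (chinv (chmul \<gamma> \<phi>)) (chinv \<nu>) w) =
      q\<^sup>2 * \<gamma> (- 1) * \<phi> (- 1) * \<gamma> 4 * \<nu> 4 * G (chmul \<gamma> \<nu>) / (G \<phi> * G0 \<nu> * G0 (chmul (chmul \<gamma> \<gamma>) \<nu>))" (is ?A)
    and "(\<Sum>w\<in>UNIV. T (chmul \<alpha> (chinv \<beta>)) w * chmul (chmul \<alpha> \<beta>) \<nu> w) =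
      q * \<phi> (- 1) * \<nu> (- 1) * G (chmul (chmul \<alpha> \<alpha>) \<nu>) * G (chmul (chmul \<beta> \<beta>) \<nu>) /
      (\<alpha> 4 * \<beta> 4 * \<nu> 4 * G \<phi> * G0 (chmul (chmul (chmul \<alpha> \<beta>) \<phi>) \<nu>))" (is ?B)
proof -
  have sq: "\<eta> (- 1) * \<eta> (- 1) = 1" "\<eta> (- 1) * (\<eta> (- 1) * x) = x" if "\<eta> \<in> mchars" for \<eta> :: "'a \<Rightarrow> complex" and x
    using mchar_minus_1_square[OF that] by (simp_all flip: mult.assoc)
  have inv: "chinv \<eta> (- 1) = \<eta> (- 1)" "chinv \<eta> 4 = inverse (\<eta> 4)" if "\<eta> \<in> mchars" for \<eta> :: "'a \<Rightarrow> complex"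
    using that by (simp_all add: chinv_apply mchar_minus_1)
  have sgn: "chmul (chmul \<gamma> \<gamma>) \<nu> (- 1) = \<nu> (- 1)" "chmul (chmul \<beta> \<beta>) \<nu> (- 1) = \<nu> (- 1)"
    using b c by (simp_all add: chmul_def sq)
  have "\<phi> 4 = 1"
    using four_neq_0 by (auto simp: quad_char_def intro!: exI[of _ "2::'a"])
  let ?c = "chmul \<gamma> \<phi>"
  let ?X = "chmul (chinv ?c) (chinv \<nu>)"
  \<comment> \<open>The exceptional pair of \<open>T_mellin\<close> would force \<gamma> to be
    trivial.\<close>
  have "\<not> (chinv ?c = \<phi> \<and> ?X = \<phi>)"
  proof
    assume "chinv ?c = \<phi> \<and> ?X = \<phi>"
    then have "chmul (chmul (chinv \<gamma>) \<phi>) \<phi> = \<epsilon>" by simp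
    then show False using c c1 by (simp add: chmul_assoc)
  qed
  then have "(\<Sum>w\<in>UNIV. T (chinv ?c) w * ?X w) =
      q * ?X (- 1) * G (chmul (chinv ?c) ?X) * G (chmul (chinv ?X) \<phi>) / (?X 4 * G \<phi> * G0 (chmul (chinv ?c) (chinv ?X)))"
    using c v by (intro T_mellin) simp_all
  also have "chmul (chinv ?X) \<phi> = chmul \<gamma> \<nu>" using c v by (simp add: chmul_ac)
  also have "chinv ?X = chmul ?c \<nu>" using c v by simp
  also have "chmul (chinv ?c) (chmul ?c \<nu>) = \<nu>" using c v by (intro chmul_chinv_cancel) simp_all
  \<comment> \<open>Squaring \<open>?c\<close> removes its factor \<phi>, which is how \<gamma>^2
    becomes a lower parameter.\<close>
  also have "chmul (chinv ?c) ?X = chinv (chmul (chmul \<gamma> \<gamma>) \<nu>)"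
    using c v by (simp add: chmul_ac)
  also have "G (chinv (chmul (chmul \<gamma> \<gamma>) \<nu>)) = q * \<nu> (- 1) / G0 (chmul (chmul \<gamma> \<gamma>) \<nu>)"
    using c v sgn(1) by (subst gauss_chinv) simp_all
  also have "?X (- 1) = \<gamma> (- 1) * \<phi> (- 1) * \<nu> (- 1)"
    using c v by simp (simp add: chmul_def inv)
  also have "?X 4 = inverse (\<gamma> 4) * inverse (\<nu> 4)"
    using c v \<open>\<phi> 4 = 1\<close> by simp (simp add: chmul_def inv)
  also have "q * (\<gamma> (- 1) * \<phi> (- 1) * \<nu> (- 1)) * (q * \<nu> (- 1) / G0 (chmul (chmul \<gamma> \<gamma>) \<nu>)) * G (chmul \<gamma> \<nu>) /
      (inverse (\<gamma> 4) * inverse (\<nu> 4) * G \<phi> * G0 \<nu>) = (\<nu> (- 1) * \<nu> (- 1)) *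
      (q\<^sup>2 * \<gamma> (- 1) * \<phi> (- 1) * \<gamma> 4 * \<nu> 4 * G (chmul \<gamma> \<nu>) / (G \<phi> * G0 \<nu> * G0 (chmul (chmul \<gamma> \<gamma>) \<nu>)))"
    by (simp add: divide_inverse power2_eq_square mult_ac)
  finally show ?A unfolding sq(1)[OF v] by simp
  let ?d = "chmul \<alpha> (chinv \<beta>)"
  let ?Y = "chmul (chmul \<alpha> \<beta>) \<nu>"
  let ?p = "chmul (chmul (chmul \<alpha> \<beta>) \<phi>) \<nu>"
  have "?d \<noteq> \<phi>" using ab by auto
  then have "(\<Sum>w\<in>UNIV. T ?d w * ?Y w) =
      q * ?Y (- 1) * G (chmul ?d ?Y) * G (chmul (chinv ?Y) \<phi>) / (?Y 4 * G \<phi> * G0 (chmul ?d (chinv ?Y)))"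
    using a b v by (intro T_mellin) simp_all
  also have "chmul ?d ?Y = chmul (chmul \<alpha> \<alpha>) \<nu>" by (rule chmul_quotient_product[OF a b])
  also have "chmul (chinv ?Y) \<phi> = chinv ?p" by (simp add: chmul_ac)
  also have "chmul ?d (chinv ?Y) = chinv (chmul (chmul \<beta> \<beta>) \<nu>)"
    using a b v by (simp add: chmul_ac)
  also have "G (chinv ?p) = q * ?p (- 1) / G0 ?p"
    using a b v by (intro gauss_chinv) simp
  also have "G0 (chinv (chmul (chmul \<beta> \<beta>) \<nu>)) = q * \<nu> (- 1) / G (chmul (chmul \<beta> \<beta>) \<nu>)"
    using b v sgn(2) by (subst gauss_chinv) simp_all
  also have "?Y 4 = \<alpha> 4 * \<beta> 4 * \<nu> 4" by (simp add: chmul_def)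
  also have "?p (- 1) = \<phi> (- 1) * ?Y (- 1)" by (simp add: chmul_def)
  also have "q * ?Y (- 1) * G (chmul (chmul \<alpha> \<alpha>) \<nu>) * (q * (\<phi> (- 1) * ?Y (- 1)) / G0 ?p) /
      (\<alpha> 4 * \<beta> 4 * \<nu> 4 * G \<phi> * (q * \<nu> (- 1) / G (chmul (chmul \<beta> \<beta>) \<nu>))) = (?Y (- 1) * ?Y (- 1)) *
      (q * \<phi> (- 1) * inverse (\<nu> (- 1)) * G (chmul (chmul \<alpha> \<alpha>) \<nu>) * G (chmul (chmul \<beta> \<beta>) \<nu>) /
      (\<alpha> 4 * \<beta> 4 * \<nu> 4 * G \<phi> * G0 ?p))"
    by (simp add: divide_inverse mult_ac)
  finally show ?B
    unfolding sq(1)[OF chmul_mchar[OF chmul_mchar[OF a b] v]] mchar_minus_1[OF v] by simp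
qed

lemma sum_kloosterman_eq_F32:
  assumes a: "\<alpha> \<in> mchars" and b: "\<beta> \<in> mchars" and c: "\<gamma> \<in> mchars"
    and ab: "chmul (chmul \<alpha> (chinv \<beta>)) \<phi> \<noteq> \<epsilon>" and c1: "\<gamma> \<noteq> \<epsilon>" and l: "l \<noteq> 1"
  shows "(\<Sum>z\<in>UNIV. kloosterman \<alpha> \<beta> z * J (chmul \<gamma> \<phi>) (l\<^sup>2 * z) * J \<phi> ((1 - l)\<^sup>2 * z)) =
    q\<^sup>2 * \<gamma> (- 1) * \<gamma> 4 * G (chmul \<alpha> \<alpha>) * G (chmul \<beta> \<beta>) * G \<gamma> /
    (\<alpha> 4 * \<beta> 4 * G \<phi> * G0 (chmul (chmul \<alpha> \<beta>) \<phi>) * G0 (chmul \<gamma> \<gamma>)) *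
    F32 \<psi> (chmul \<alpha> \<alpha>) (chmul \<beta> \<beta>) \<gamma> (chmul (chmul \<alpha> \<beta>) \<phi>) (chmul \<gamma> \<gamma>) l"
    (is "?S = ?K * F32 _ _ _ _ _ _ _")
proof -
  let ?c = "chmul \<gamma> \<phi>" and ?d = "chmul \<alpha> (chinv \<beta>)" and ?ab = "chmul \<alpha> \<beta>"
  define R where "R \<nu> = G (chmul (chmul \<alpha> \<alpha>) \<nu>) * G (chmul (chmul \<beta> \<beta>) \<nu>) * G (chmul \<gamma> \<nu>) /
    (G0 \<nu> * G0 (chmul (chmul ?ab \<phi>) \<nu>) * G0 (chmul (chmul \<gamma> \<gamma>) \<nu>))" for \<nu>
  define f where "f u = chinv ?c u * T (chinv ?c) u" for u
  define F where "F \<nu> = (\<Sum>w\<in>UNIV. f w * chinv \<nu> w)" for \<nu>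
  have ci: "chinv ?c \<in> mchars" using c by simp
  have S1: "?S = - G \<phi> * (\<Sum>w\<in>UNIV. kloosterman \<alpha> \<beta> (w\<^sup>2) * J ?c (l\<^sup>2 * w\<^sup>2) * \<psi> (2 * (1 - l) * w))"
    by (rule sum_salie) (use l in \<open>simp_all add: kloosterman_0\<close>)
  have S2: "(\<Sum>w\<in>UNIV. kloosterman \<alpha> \<beta> (w\<^sup>2) * J ?c (l\<^sup>2 * w\<^sup>2) * \<psi> (2 * (1 - l) * w)) =
      (\<Sum>w\<in>UNIV. ?ab (- w) * T ?d (- w) * f (l * w))"
  proof (rule sum.cong[OF refl])
    fix w :: 'a
    \<comment> \<open>\<open>kloosterman_square\<close> asks for the phase \<open>- (2 * w)\<close>.
      So one sum is read at \<open>- w\<close>, which has the same square as \<open>w\<close>, and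
      the other at \<open>l * w\<close>.\<close>
    have "\<psi> (2 * (1 - l) * w) = \<psi> (- (2 * - w)) * \<psi> (- (2 * (l * w)))"
      by (simp add: algebra_simps flip: psi_add)
    then have "kloosterman \<alpha> \<beta> (w\<^sup>2) * J ?c (l\<^sup>2 * w\<^sup>2) * \<psi> (2 * (1 - l) * w) =
        (kloosterman \<alpha> \<beta> ((- w)\<^sup>2) * \<psi> (- (2 * - w))) * (J ?c ((l * w)\<^sup>2) * \<psi> (- (2 * (l * w))))"
      by (simp add: power_mult_distrib)
    also have "\<dots> = ?ab (- w) * T ?d (- w) * f (l * w)"
      unfolding kloosterman_square[OF a b] kloosterman_square[OF ci triv_char_mchar]
      using c by (simp add: f_def)
    finally show "kloosterman \<alpha> \<beta> (w\<^sup>2) * J ?c (l\<^sup>2 * w\<^sup>2) * \<psi> (2 * (1 - l) * w) =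
        ?ab (- w) * T ?d (- w) * f (l * w)" .
  qed
  note S = S1[unfolded S2]
  have "f 0 = 0" unfolding f_def mchar_0[OF ci] by simp
  \<comment> \<open>Only \<open>f\<close> involves \<open>l\<close>; expanding it by Mellin
    inversion turns the correlation into a series in \<open>\<nu> l\<close>. The factor
    \<open>q - 1\<close> belongs to the inversion formula.\<close>
  have "(q - 1) * (\<Sum>w\<in>UNIV. ?ab (- w) * T ?d (- w) * f (l * w)) =
      (\<Sum>w\<in>UNIV. ?ab (- w) * T ?d (- w) * ((q - 1) * f (l * w)))"
    by (simp add: sum_distrib_left mult_ac)
  also have "\<dots> = (\<Sum>w\<in>UNIV. \<Sum>\<nu>\<in>mchars. F \<nu> * (?ab (- w) * T ?d (- w) * \<nu> (l * w)))"
    unfolding q_eq mellin_inversion[of f, OF \<open>f 0 = 0\<close>, symmetric] F_def[symmetric]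
    by (simp add: sum_distrib_left mult_ac)
  also have "\<dots> = (\<Sum>\<nu>\<in>mchars. F \<nu> * (\<Sum>w\<in>UNIV. ?ab (- w) * T ?d (- w) * \<nu> (l * w)))"
    by (subst sum.swap) (simp add: sum_distrib_left)
  also have "\<dots> = (\<Sum>\<nu>\<in>mchars. q ^ 3 * \<gamma> (- 1) * \<gamma> 4 / (\<alpha> 4 * \<beta> 4 * (G \<phi>)\<^sup>2) * (R \<nu> * \<nu> l))"
  proof (rule sum.cong[OF refl])
    fix \<nu> :: "'a \<Rightarrow> complex" assume v: "\<nu> \<in> mchars"
    have F: "F \<nu> = (\<Sum>w\<in>UNIV. T (chinv ?c) w * chmul (chinv ?c) (chinv \<nu>) w)"
      by (simp add: F_def f_def chmul_def mult_ac)
    \<comment> \<open>Replacing \<open>w\<close> by \<open>- w\<close> produces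
      \<open>\<nu> (- 1)\<close>, which cancels the same sign in the second Mellin
      coefficient.\<close>
    have "(\<Sum>w\<in>UNIV. ?ab (- w) * T ?d (- w) * \<nu> (l * w)) = (\<Sum>w\<in>UNIV. ?ab w * T ?d w * \<nu> (l * - w))"
      by (rule sum.reindex_bij_witness[where i = uminus and j = uminus]) auto
    also have "\<dots> = (\<Sum>w\<in>UNIV. \<nu> (- 1) * \<nu> l * (T ?d w * chmul ?ab \<nu> w))"
    proof (rule sum.cong[OF refl])
      fix w :: 'a
      have "\<nu> (l * - w) = \<nu> (- 1) * \<nu> l * \<nu> w"
        by (simp add: mchar_mult[OF v, symmetric])
      then show "?ab w * T ?d w * \<nu> (l * - w) = \<nu> (- 1) * \<nu> l * (T ?d w * chmul ?ab \<nu> w)"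
        by (simp add: chmul_def mult_ac)
    qed
    finally have M: "(\<Sum>w\<in>UNIV. ?ab (- w) * T ?d (- w) * \<nu> (l * w)) =
        \<nu> (- 1) * \<nu> l * (\<Sum>w\<in>UNIV. T ?d w * chmul ?ab \<nu> w)"
      by (simp only: sum_distrib_left)
    have "\<nu> 4 \<noteq> 0" using four_neq_0 by (simp add: mchar_eq_0_iff[OF v])
    have "F \<nu> * (\<Sum>w\<in>UNIV. ?ab (- w) * T ?d (- w) * \<nu> (l * w)) =
        (\<phi> (- 1) * \<phi> (- 1)) * (\<nu> (- 1) * \<nu> (- 1)) *
        (q ^ 3 * \<gamma> (- 1) * \<gamma> 4 / (\<alpha> 4 * \<beta> 4 * (G \<phi>)\<^sup>2) * (R \<nu> * \<nu> l))"
      unfolding F M mellin_coefficients[OF a b c v ab c1] R_def using \<open>\<nu> 4 \<noteq> 0\<close>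
      by (simp add: power2_eq_square power3_eq_cube mult_ac)
    then show "F \<nu> * (\<Sum>w\<in>UNIV. ?ab (- w) * T ?d (- w) * \<nu> (l * w)) =
        q ^ 3 * \<gamma> (- 1) * \<gamma> 4 / (\<alpha> 4 * \<beta> 4 * (G \<phi>)\<^sup>2) * (R \<nu> * \<nu> l)"
      unfolding mchar_minus_1_square[OF v] mchar_minus_1_square[OF phi_mchar] by simp
  qed
  also have "\<dots> = q ^ 3 * \<gamma> (- 1) * \<gamma> 4 / (\<alpha> 4 * \<beta> 4 * (G \<phi>)\<^sup>2) * (\<Sum>\<nu>\<in>mchars. R \<nu> * \<nu> l)"
    by (simp only: sum_distrib_left)
  finally have main: "(q - 1) * (\<Sum>w\<in>UNIV. ?ab (- w) * T ?d (- w) * f (l * w)) =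
      q ^ 3 * \<gamma> (- 1) * \<gamma> 4 / (\<alpha> 4 * \<beta> 4 * (G \<phi>)\<^sup>2) * (\<Sum>\<nu>\<in>mchars. R \<nu> * \<nu> l)" .
  \<comment> \<open>\<open>?L\<close> collects the normalising Gauss sums of the six Pochhammer
    quotients; its factor \<open>q\<close> is \<open>G0\<close> of the trivial character.\<close>
  let ?L = "q * G0 (chmul ?ab \<phi>) * G0 (chmul \<gamma> \<gamma>) / (G (chmul \<alpha> \<alpha>) * G (chmul \<beta> \<beta>) * G \<gamma>)"
  have "(\<Sum>\<nu>\<in>mchars. poch \<psi> (chmul \<alpha> \<alpha>) \<nu> * poch \<psi> (chmul \<beta> \<beta>) \<nu> * poch \<psi> \<gamma> \<nu> /
        (poch0 \<psi> triv_char \<nu> * poch0 \<psi> (chmul ?ab \<phi>) \<nu> * poch0 \<psi> (chmul \<gamma> \<gamma>) \<nu>) * \<nu> l) =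
      (\<Sum>\<nu>\<in>mchars. ?L * (R \<nu> * \<nu> l))"
    by (rule sum.cong[OF refl]) (simp add: poch_def poch0_def R_def)
  then have F32: "(1 - q) * F32 \<psi> (chmul \<alpha> \<alpha>) (chmul \<beta> \<beta>) \<gamma> (chmul ?ab \<phi>) (chmul \<gamma> \<gamma>) l =
      ?L * (\<Sum>\<nu>\<in>mchars. R \<nu> * \<nu> l)"
    using q_neq_1 by (simp add: F32_def sum_distrib_left flip: q_eq)
  \<comment> \<open>The factor 1 - q from the definition of the 3F2 absorbs the minus sign of the
    Salie formula.\<close>
  have neg: "- u * ((1 - q) * v) = u * ((q - 1) * v)" for u v
    by (simp add: algebra_simps)
  have "(q - 1) * ?S = - G \<phi> * ((q - 1) * (\<Sum>w\<in>UNIV. ?ab (- w) * T ?d (- w) * f (l * w)))"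
    unfolding S by (simp only: mult.left_commute)
  also have "\<dots> = - ?K * (?L * (\<Sum>\<nu>\<in>mchars. R \<nu> * \<nu> l))"
    unfolding main using a b c by (simp add: power2_eq_square power3_eq_cube)
  also have "\<dots> = (q - 1) * (?K * F32 \<psi> (chmul \<alpha> \<alpha>) (chmul \<beta> \<beta>) \<gamma> (chmul ?ab \<phi>) (chmul \<gamma> \<gamma>) l)"
    unfolding F32[symmetric] neg by (rule mult.left_commute)
  finally show ?thesis using q_neq_1 by (simp only: mult_cancel_left) simp
qed

text \<open>Duplication carries over to \<open>G0\<close> because the powers of \<open>q\<close>
  agree: for nontrivial \<gamma>, both \<gamma>\<phi> and \<gamma>^2 are trivial exactly when
  \<gamma> = \<phi>.\<close>

lemma gauss0_quadratic_twist:
  assumes c: "\<gamma> \<in> mchars" and c1: "\<gamma> \<noteq> \<epsilon>"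
  shows "G0 (chmul \<gamma> \<phi>) * G \<gamma> * \<gamma> 4 = G \<phi> * G0 (chmul \<gamma> \<gamma>)"
proof -
  have hd: "G \<gamma> * G (chmul \<gamma> \<phi>) * \<gamma> 4 = G (chmul \<gamma> \<gamma>) * G \<phi>"
    by (rule hasse_davenport_2[OF c])
  have "chmul \<gamma> \<phi> = \<epsilon> \<longleftrightarrow> chmul \<gamma> \<gamma> = \<epsilon>"
  proof
    assume "chmul \<gamma> \<phi> = \<epsilon>"
    then have "chmul (chmul \<gamma> \<phi>) \<phi> = \<phi>" by simp
    then have "\<gamma> = \<phi>" using c by (simp add: chmul_assoc)
    then show "chmul \<gamma> \<gamma> = \<epsilon>" by simp
  next
    assume "chmul \<gamma> \<gamma> = \<epsilon>"
    then show "chmul \<gamma> \<phi> = \<epsilon>"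
      using mchar_square_eq_triv[OF two_neq_0 c] c1 by auto
  qed
  then show ?thesis using hd by (simp add: gauss0_def delta_def mult_ac)
qed

text \<open>Duplication for \<alpha>, \<beta> and \<gamma> removes the Gauss sums of their squares
  together with all values at 4, and reflection exchanges \<open>G0 ?d\<close> for
  \<open>G ?e\<close>.\<close>

lemma F4_inverted_eq_F32:
  assumes a: "\<alpha> \<in> mchars" and b: "\<beta> \<in> mchars" and c: "\<gamma> \<in> mchars"
    and ab: "chmul (chmul \<alpha> (chinv \<beta>)) \<phi> \<noteq> \<epsilon>" and c1: "\<gamma> \<noteq> \<epsilon>" and l: "l \<noteq> 1"
  shows "chmul (chinv \<alpha>) (chinv \<alpha>) (1 - l) *
      F4 \<psi> \<alpha> (chmul \<alpha> \<phi>) (chmul \<gamma> \<phi>) (chmul \<alpha> (chinv \<beta>)) (l\<^sup>2 / (1 - l)\<^sup>2) (1 / (1 - l)\<^sup>2) =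
    G \<beta> * G (chmul \<beta> \<phi>) / (G (chmul (chinv \<alpha>) \<beta>) * G0 (chmul (chmul \<alpha> \<beta>) \<phi>)) *
    F32 \<psi> (chmul \<alpha> \<alpha>) (chmul \<beta> \<beta>) \<gamma> (chmul (chmul \<alpha> \<beta>) \<phi>) (chmul \<gamma> \<gamma>) l"
proof -
  let ?c = "chmul \<gamma> \<phi>" and ?d = "chmul \<alpha> (chinv \<beta>)" and ?e = "chmul (chinv \<alpha>) \<beta>"
  let ?F = "F32 \<psi> (chmul \<alpha> \<alpha>) (chmul \<beta> \<beta>) \<gamma> (chmul (chmul \<alpha> \<beta>) \<phi>) (chmul \<gamma> \<gamma>) l"
  have mc: "?c \<in> mchars" "?d \<in> mchars" "?e \<in> mchars" using a b c by auto
  have e: "chinv ?e = ?d" using a b by simp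
  have s: "?e (- 1) = ?d (- 1)"
    by (simp add: chmul_def chinv_apply[OF a] chinv_apply[OF b] mchar_minus_1[OF a] mchar_minus_1[OF b])
  have l': "1 - l \<noteq> 0" using l by simp
  have nz: "\<alpha> 4 \<noteq> 0" "\<beta> 4 \<noteq> 0" "\<gamma> 4 \<noteq> 0"
    using four_neq_0 by (simp_all add: mchar_eq_0_iff a b c)
  have gd: "G0 ?d = q * ?d (- 1) / G ?e"
    using gauss_chinv(2)[OF mc(3)] unfolding e s .
  have ga: "G (chmul \<alpha> \<alpha>) = G \<alpha> * G (chmul \<alpha> \<phi>) * \<alpha> 4 / G \<phi>"
    using hasse_davenport_2[OF a] by simp
  have gb: "G (chmul \<beta> \<beta>) = G \<beta> * G (chmul \<beta> \<phi>) * \<beta> 4 / G \<phi>"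
    using hasse_davenport_2[OF b] by simp
  have gc: "G0 ?c = G \<phi> * G0 (chmul \<gamma> \<gamma>) / (G \<gamma> * \<gamma> 4)"
    using gauss0_quadratic_twist[OF c c1] nz c by (simp add: field_simps)
  have mc1: "?c (- 1) = \<gamma> (- 1) * \<phi> (- 1)" by (simp add: chmul_def)
  \<comment> \<open>The three extra factors are each 1: two squares of signs, and the quotient given
    by \<open>gauss_phi_square\<close>.\<close>
  have "chmul (chinv \<alpha>) (chinv \<alpha>) (1 - l) *
      F4 \<psi> \<alpha> (chmul \<alpha> \<phi>) ?c ?d (l\<^sup>2 / (1 - l)\<^sup>2) (1 / (1 - l)\<^sup>2) =
      (\<gamma> (- 1) * \<gamma> (- 1)) * (?d (- 1) * ?d (- 1)) * (q * \<phi> (- 1) / (G \<phi> * G \<phi>)) *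
      (G \<beta> * G (chmul \<beta> \<phi>) / (G ?e * G0 (chmul (chmul \<alpha> \<beta>) \<phi>)) * ?F)"
    unfolding F4_inversion[OF a b mc(1) l'] sum_kloosterman_eq_F32[OF a b c ab c1 l] gd ga gb gc mc1
    using nz a b c by (simp add: power2_eq_square mult_ac)
  then show ?thesis
    unfolding mchar_minus_1_square[OF c] mchar_minus_1_square[OF mc(2)] gauss_phi_square
    by (simp add: mchar_eq_0_iff[OF phi_mchar])
qed

end

theorem theorem3p16:
  fixes \<psi> :: "'a::{field,finite} \<Rightarrow> complex"
    and \<alpha> \<beta> \<gamma> :: "'a \<Rightarrow> complex"
  assumes "nontriv_add_char \<psi>"
    and "CHAR('a) \<noteq> 2"
    and "\<alpha> \<in> mchars" and "\<beta> \<in> mchars" and "\<gamma> \<in> mchars"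
  shows "(\<forall>lam::'a. F4 \<psi> \<alpha> \<beta> (chmul \<gamma> quad_char) quad_char (lam^2) ((1 - lam)^2) =
            poch \<psi> \<alpha> quad_char * poch \<psi> \<beta> quad_char *
            F4 \<psi> (chmul \<alpha> quad_char) (chmul \<beta> quad_char) (chmul \<gamma> quad_char) quad_char
               (lam^2) ((1 - lam)^2)) \<and>
         (triv_char \<notin> {\<alpha>, chmul (chinv \<beta>) \<gamma>} \<longrightarrow>
           (\<forall>lam::'a. lam \<noteq> 1 \<longrightarrow>
             F4 \<psi> \<alpha> \<beta> (chmul \<gamma> quad_char) quad_char (lam^2) ((1 - lam)^2) =
             gauss \<psi> (chmul (chinv \<alpha>) \<beta>) * gauss \<psi> (chmul \<alpha> quad_char) /
               (gauss \<psi> \<beta> * gauss \<psi> quad_char) *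
             chmul (chinv \<alpha>) (chinv \<alpha>) (1 - lam) *
             F4 \<psi> \<alpha> (chmul \<alpha> quad_char) (chmul \<gamma> quad_char) (chmul \<alpha> (chinv \<beta>))
               (lam^2 / (1 - lam)^2) (1 / (1 - lam)^2))) \<and>
         (triv_char \<notin> {chmul (chmul \<alpha> (chinv \<beta>)) quad_char, \<gamma>} \<longrightarrow>
           (\<forall>lam::'a. lam \<noteq> 1 \<longrightarrow>
             chmul (chinv \<alpha>) (chinv \<alpha>) (1 - lam) *
             F4 \<psi> \<alpha> (chmul \<alpha> quad_char) (chmul \<gamma> quad_char) (chmul \<alpha> (chinv \<beta>))
               (lam^2 / (1 - lam)^2) (1 / (1 - lam)^2) =
             gauss \<psi> \<beta> * gauss \<psi> (chmul \<beta> quad_char) /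
               (gauss \<psi> (chmul (chinv \<alpha>) \<beta>) * gauss0 \<psi> (chmul (chmul \<alpha> \<beta>) quad_char)) *
             F32 \<psi> (chmul \<alpha> \<alpha>) (chmul \<beta> \<beta>) \<gamma> (chmul (chmul \<alpha> \<beta>) quad_char) (chmul \<gamma> \<gamma>) lam))"
proof (cases "\<psi> 0 = 0")
  \<comment> \<open>\<open>nontriv_add_char\<close> admits the zero function; then all Gauss sums, hence both sides, vanish.\<close>
  case True
  then have psi: "\<psi> x = 0" for x
    using assms(1) unfolding nontriv_add_char_def by (metis add.right_neutral mult_zero_right)
  then have "gauss \<psi> \<eta> = 0" for \<eta> by (simp add: gauss_def)
  then show ?thesis
    by (simp add: F4_def F32_def poch_def)
next
  case False
  have "\<psi> 0 * \<psi> 0 = \<psi> 0"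
    using assms(1) unfolding nontriv_add_char_def by (metis add.right_neutral)
  then have "\<psi> 0 = 1" using False by simp
  moreover have "(2::'a) \<noteq> 0"
  proof
    assume "(2::'a) = 0"
    then have dvd: "CHAR('a) dvd 2"
      using of_nat_eq_0_iff_char_dvd[of 2, where 'a = 'a] by simp
    then have "CHAR('a) \<noteq> 0"
      by (metis dvd_0_left zero_neq_numeral)
    moreover have "CHAR('a) \<le> 2"
      by (rule dvd_imp_le[OF dvd]) simp
    ultimately show False using assms(2) CHAR_not_1[where 'a = 'a] by linarith
  qed
  ultimately interpret additive_character \<psi> "of_nat (card (UNIV :: 'a set))"
    using assms(1) unfolding nontriv_add_char_def by unfold_locales auto
  show ?thesis
    using F4_phi_twist[of \<alpha> \<beta> "chmul \<gamma> quad_char"] F4_eq_F4_inverted[of \<alpha> \<beta> "chmul \<gamma> quad_char"]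
      F4_inverted_eq_F32[of \<alpha> \<beta> \<gamma>] assms(3-5)
    by auto
qed

end
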